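(* Let $m\geq 43$ be an integer and let $G$ be a $\theta_{1,3,3}$-free graph with $m$ edges and no isolated vertices. Then $\lambda(G)\leq\frac{1+\sqrt{4m-3}}{2}$, and equality holds if and only if $G\cong K_2\vee\frac{m-1}{2}K_1$.
   Context: All graphs are finite and simple. $\lambda(G)$ denotes the spectral radius of $G$, i.e. the maximum modulus of the eigenvalues of its adjacency matrix. For integers $l_1\leq l_2\leq l_3$ with $l_2\geq 2$, the theta graph $\theta_{l_1,l_2,l_3}$ is the graph obtained by connecting two distinct vertices with three internally disjoint paths of lengths (numbers of edges) $l_1,l_2,l_3$; thus $\theta_{1,3,3}$ has two adjacent vertices that are also joined by two further internally disjoint paths of length $3$. A graph is $F$-free if it does not contain $F$ as a (not necessarily induced) subgraph. The join $G\vee H$ is obtained from the disjoint union of $G$ and $H$ by adding all edges between vertices of $G$ and vertices of $H$; $tK_1$ denotes the graph with $t$ vertices and no edges. The graph $K_2\vee\frac{m-1}{2}K_1$ exists only if $m$ is odd (it then has exactly $m$ edges); for even $m$ the equality statement means that equality never holds. *)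

theory Defs
  imports
    "Graph_Theory.Graph_Theory"
    "Jordan_Normal_Form.Spectral_Radius"
begin

text \<open>
  Finite simple graphs are the structures satisfying the predicate \<open>pair_graph\<close>: finite loop-free
  symmetric digraphs whose arcs are ordered pairs of vertices. An undirected edge corresponds to
  two opposite arcs.
\<close>

definition edges :: "'a pair_pre_digraph \<Rightarrow> 'a set set" where
  "edges G = {{u, v} | u v. (u, v) \<in> parcs G}"

definition no_isolated_vertices :: "'a pair_pre_digraph \<Rightarrow> bool" where
  "no_isolated_vertices G \<longleftrightarrow> (\<forall>v \<in> pverts G. \<exists>u. (v, u) \<in> parcs G)"

abbreviation graph_iso :: "'a pair_pre_digraph \<Rightarrow> 'b pair_pre_digraph \<Rightarrow> bool" where
  "graph_iso G H \<equiv> digraph_iso (with_proj G) (with_proj H)"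

text \<open>The library's \<open>subgraph\<close> is not required to be induced.\<close>

definition graph_free :: "'b pair_pre_digraph \<Rightarrow> 'a pair_pre_digraph \<Rightarrow> bool" where
  "graph_free F G \<longleftrightarrow>
     \<not> (\<exists>H :: 'a pair_pre_digraph. subgraph (with_proj H) (with_proj G) \<and> graph_iso F H)"


subsection \<open>Spectral radius\<close>

definition adjacency_matrix :: "'a pair_pre_digraph \<Rightarrow> 'a list \<Rightarrow> complex mat" where
  "adjacency_matrix G vs =
     mat (length vs) (length vs) (\<lambda>(i, j). if (vs ! i, vs ! j) \<in> parcs G then 1 else 0)"

text \<open>
  The adjacency matrix depends on an ordering of the vertices, its spectral radius does not;
  see \<open>graph_spectral_radius_eq\<close> below. The value is meaningless for the graph without vertices.
\<close>

definition graph_spectral_radius :: "'a pair_pre_digraph \<Rightarrow> real" where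
  "graph_spectral_radius G =
     spectral_radius (adjacency_matrix G (SOME vs. distinct vs \<and> set vs = pverts G))"

lemma eigenvalue_adjacency_matrix_reorder:
  assumes "distinct vs" "distinct ws" "set vs = set ws"
    and "eigenvalue (adjacency_matrix G vs) k"
  shows "eigenvalue (adjacency_matrix G ws) k"
proof -
  define n where "n = length vs"
  have n: "length ws = n" using assms(1-3) n_def by (metis distinct_card)
  have "\<exists>p. \<forall>i<n. p i < n \<and> ws ! i = vs ! p i"
  proof (rule exI[of _ "\<lambda>i. SOME j. j < n \<and> ws ! i = vs ! j"], intro allI impI)
    fix i assume "i < n"
    then have "ws ! i \<in> set vs" using assms(3) n by simp
    then have "\<exists>j. j < n \<and> ws ! i = vs ! j" by (auto simp: in_set_conv_nth n_def)
    then show "(SOME j. j < n \<and> ws ! i = vs ! j) < n \<and>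
        ws ! i = vs ! (SOME j. j < n \<and> ws ! i = vs ! j)" by (rule someI_ex)
  qed
  then obtain p where p: "p i < n" "ws ! i = vs ! p i" if "i < n" for i by blast
  have "inj_on p {..<n}"
    using p assms(2) n by (intro inj_onI) (metis lessThan_iff nth_eq_iff_index_eq)
  moreover have "p ` {..<n} \<subseteq> {..<n}" using p by auto
  ultimately have bij: "bij_betw p {..<n} {..<n}"
    by (simp add: bij_betw_def endo_inj_surj)
  obtain x where x: "x \<in> carrier_vec n" "x \<noteq> 0\<^sub>v n"
    "adjacency_matrix G vs *\<^sub>v x = k \<cdot>\<^sub>v x"
    using assms(4) unfolding eigenvalue_def eigenvector_def
    by (auto simp: adjacency_matrix_def n_def)
  have ev: "(\<Sum>j<n. (if (vs ! i, vs ! j) \<in> parcs G then 1 else 0) * x $ j) = k * x $ i"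
    if "i < n" for i
  proof -
    have "(adjacency_matrix G vs *\<^sub>v x) $ i = (k \<cdot>\<^sub>v x) $ i" using x by simp
    then show ?thesis using that x(1)
      by (simp add: adjacency_matrix_def scalar_prod_def n_def lessThan_atLeast0)
  qed
  define y where "y = vec n (\<lambda>i. x $ p i)"
  have "y \<noteq> 0\<^sub>v n"
  proof
    assume y0: "y = 0\<^sub>v n"
    have "x $ j = 0" if j: "j < n" for j
    proof -
      have "j \<in> p ` {..<n}" using bij j by (simp add: bij_betw_def)
      then obtain i where "i < n" "p i = j" by auto
      then show ?thesis using arg_cong[OF y0, of "\<lambda>v. v $ i"] by (simp add: y_def)
    qed
    then have "x = 0\<^sub>v n" using x(1) by auto
    with x(2) show False by simp
  qed
  moreover have "adjacency_matrix G ws *\<^sub>v y = k \<cdot>\<^sub>v y"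
  proof (rule eq_vecI)
    show "dim_vec (adjacency_matrix G ws *\<^sub>v y) = dim_vec (k \<cdot>\<^sub>v y)"
      by (simp add: adjacency_matrix_def y_def n)
    fix i assume "i < dim_vec (k \<cdot>\<^sub>v y)"
    then have i: "i < n" by (simp add: y_def)
    have "(adjacency_matrix G ws *\<^sub>v y) $ i =
        (\<Sum>j<n. (if (ws ! i, ws ! j) \<in> parcs G then 1 else 0) * y $ j)"
      using i n by (simp add: adjacency_matrix_def scalar_prod_def y_def lessThan_atLeast0)
    also have "\<dots> = (\<Sum>j<n. (if (vs ! p i, vs ! p j) \<in> parcs G then 1 else 0) * x $ p j)"
      using p i by (intro sum.cong) (auto simp: y_def)
    also have "\<dots> = (\<Sum>j<n. (if (vs ! p i, vs ! j) \<in> parcs G then 1 else 0) * x $ j)"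
      by (rule sum.reindex_bij_betw[OF bij])
    also have "\<dots> = k * x $ p i" using ev p(1) i by simp
    finally show "(adjacency_matrix G ws *\<^sub>v y) $ i = (k \<cdot>\<^sub>v y) $ i"
      using i by (simp add: y_def)
  qed
  ultimately show ?thesis
    unfolding eigenvalue_def eigenvector_def
    by (intro exI[of _ y]) (auto simp: adjacency_matrix_def n y_def)
qed

lemma graph_spectral_radius_eq:
  assumes "distinct vs" "set vs = pverts G"
  shows "graph_spectral_radius G = spectral_radius (adjacency_matrix G vs)"
proof -
  let ?ws = "SOME vs. distinct vs \<and> set vs = pverts G"
  have ws: "distinct ?ws \<and> set ?ws = pverts G" by (rule someI[of _ vs]) (use assms in simp)
  have "spectrum (adjacency_matrix G ?ws) = spectrum (adjacency_matrix G vs)"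
    unfolding spectrum_def
    using eigenvalue_adjacency_matrix_reorder[of ?ws vs G]
      eigenvalue_adjacency_matrix_reorder[of vs ?ws G] ws assms by auto
  then show ?thesis by (simp add: graph_spectral_radius_def spectral_radius_def)
qed


subsection \<open>Theta graphs\<close>

text \<open>
  \<open>theta_path i l\<close> lists the vertices of the \<open>i\<close>-th path, which has \<open>l \<ge> 1\<close> edges and
  internal vertices \<open>Internal i 1, \<dots>, Internal i (l - 1)\<close>.
\<close>

datatype theta_vertex = Source | Sink | Internal nat nat

definition theta_path :: "nat \<Rightarrow> nat \<Rightarrow> theta_vertex list" where
  "theta_path i l = Source # map (Internal i) [1..<l] @ [Sink]"

definition path_graph :: "'a list \<Rightarrow> 'a pair_pre_digraph" where
  "path_graph p = \<lparr>pverts = set p, parcs = (set (zip p (tl p)))\<^sup>s\<rparr>"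

definition graph_union :: "'a pair_pre_digraph \<Rightarrow> 'a pair_pre_digraph \<Rightarrow> 'a pair_pre_digraph" where
  "graph_union G H = \<lparr>pverts = pverts G \<union> pverts H, parcs = parcs G \<union> parcs H\<rparr>"

definition theta_graph :: "nat \<Rightarrow> nat \<Rightarrow> nat \<Rightarrow> theta_vertex pair_pre_digraph" where
  "theta_graph l1 l2 l3 =
     graph_union (path_graph (theta_path 1 l1))
       (graph_union (path_graph (theta_path 2 l2)) (path_graph (theta_path 3 l3)))"


subsection \<open>Joins\<close>

definition complete_graph :: "nat \<Rightarrow> nat pair_pre_digraph" where
  "complete_graph n = \<lparr>pverts = {..<n}, parcs = {(u, v). u < n \<and> v < n \<and> u \<noteq> v}\<rparr>"

definition empty_graph :: "nat \<Rightarrow> nat pair_pre_digraph" where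
  "empty_graph t = \<lparr>pverts = {..<t}, parcs = {}\<rparr>"

definition graph_join ::
    "'a pair_pre_digraph \<Rightarrow> 'b pair_pre_digraph \<Rightarrow> ('a + 'b) pair_pre_digraph" where
  "graph_join G H = \<lparr>
     pverts = pverts G <+> pverts H,
     parcs = map_prod Inl Inl ` parcs G \<union> map_prod Inr Inr ` parcs H \<union>
       (Inl ` pverts G \<times> Inr ` pverts H)\<^sup>s\<rparr>"


subsection \<open>Well-formedness and unfolded forms\<close>

text \<open>
  \<open>digraph_iso\<close> is false for ill-formed digraphs, so the graphs above have to be well-formed for
  \<open>graph_free\<close> and \<open>graph_iso\<close> to have their intended meaning.
\<close>

lemma pair_graph_iff:
  "pair_graph G \<longleftrightarrow> finite (pverts G) \<and> parcs G \<subseteq> pverts G \<times> pverts G \<and>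
     sym (parcs G) \<and> irrefl (parcs G)"
proof
  assume "pair_graph G"
  then interpret pair_graph G .
  show "finite (pverts G) \<and> parcs G \<subseteq> pverts G \<times> pverts G \<and> sym (parcs G) \<and> irrefl (parcs G)"
    using pair_finite_verts pair_sym_arcs pair_no_loops in_arcsD1 in_arcsD2
    by (fastforce simp: symmetric_def irrefl_def)
next
  assume G: "finite (pverts G) \<and> parcs G \<subseteq> pverts G \<times> pverts G \<and> sym (parcs G) \<and> irrefl (parcs G)"
  then have "finite (parcs G)" by (meson finite_SigmaI finite_subset)
  with G show "pair_graph G"
    by unfold_locales (auto simp: symmetric_def irrefl_def)
qed

lemma graph_iso_iff:
  assumes "pair_graph G"
  shows "graph_iso G H \<longleftrightarrow>
    (\<exists>f. bij_betw f (pverts G) (pverts H) \<and> parcs H = map_prod f f ` parcs G)"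
proof
  assume "graph_iso G H"
  then obtain h where h: "pre_digraph.digraph_isomorphism (with_proj G) h"
    and H: "with_proj H = app_iso h (with_proj G)"
    by (auto simp: digraph_iso_def)
  have H': "pverts H = iso_verts h ` pverts G" "parcs H = iso_arcs h ` parcs G"
    "iso_tail h = fst" "iso_head h = snd"
    using H by (auto simp: with_proj_def app_iso_def)
  have inj: "inj_on (iso_verts h) (pverts G)"
    using h by (auto simp: pre_digraph.digraph_isomorphism_def)
  have "iso_arcs h a = map_prod (iso_verts h) (iso_verts h) a" if "a \<in> parcs G" for a
    using h that H'
    by (cases a) (auto simp: pre_digraph.digraph_isomorphism_def prod_eq_iff)
  then have "parcs H = map_prod (iso_verts h) (iso_verts h) ` parcs G"
    unfolding H'(2) by (intro image_cong) auto
  with inj H' show "\<exists>f. bij_betw f (pverts G) (pverts H) \<and> parcs H = map_prod f f ` parcs G"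
    by (auto simp: bij_betw_def intro!: exI[of _ "iso_verts h"])
next
  assume "\<exists>f. bij_betw f (pverts G) (pverts H) \<and> parcs H = map_prod f f ` parcs G"
  then obtain f where f: "inj_on f (pverts G)" "pverts H = f ` pverts G"
    "parcs H = map_prod f f ` parcs G" by (auto simp: bij_betw_def)
  interpret pair_graph G by fact
  let ?h = "\<lparr>iso_verts = f, iso_arcs = map_prod f f, iso_head = snd, iso_tail = fst\<rparr>"
  have "inj_on (map_prod f f) (parcs G)"
    by (rule inj_on_subset[OF map_prod_inj_on[OF f(1) f(1)]]) (auto dest: in_arcsD1 in_arcsD2)
  then have "pre_digraph.digraph_isomorphism (with_proj G) ?h"
    using f wf_digraph_axioms by (auto simp: pre_digraph.digraph_isomorphism_def)
  moreover have "with_proj H = app_iso ?h (with_proj G)"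
    using f by (simp add: with_proj_def app_iso_def)
  ultimately show "graph_iso G H" by (auto simp: digraph_iso_def)
qed

lemma graph_free_iff:
  fixes F :: "'b pair_pre_digraph" and G :: "'a pair_pre_digraph"
  assumes F: "pair_graph F" and G: "pair_graph G"
  shows "graph_free F G \<longleftrightarrow>
    \<not> (\<exists>f. inj_on f (pverts F) \<and> f ` pverts F \<subseteq> pverts G \<and> map_prod f f ` parcs F \<subseteq> parcs G)"
proof -
  have "(\<exists>H :: 'a pair_pre_digraph. subgraph (with_proj H) (with_proj G) \<and> graph_iso F H) \<longleftrightarrow>
    (\<exists>f. inj_on f (pverts F) \<and> f ` pverts F \<subseteq> pverts G \<and> map_prod f f ` parcs F \<subseteq> parcs G)"
    (is "?L \<longleftrightarrow> ?R")
  proof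
    assume ?L
    then obtain H :: "'a pair_pre_digraph" and f where "subgraph (with_proj H) (with_proj G)"
      "bij_betw f (pverts F) (pverts H)" "parcs H = map_prod f f ` parcs F"
      unfolding graph_iso_iff[OF F] by blast
    then show ?R by (intro exI[of _ f]) (auto simp: subgraph_def bij_betw_def)
  next
    assume ?R
    then obtain f where f: "inj_on f (pverts F)" "f ` pverts F \<subseteq> pverts G"
      "map_prod f f ` parcs F \<subseteq> parcs G" by blast
    let ?H = "\<lparr>pverts = f ` pverts F, parcs = map_prod f f ` parcs F\<rparr>"
    interpret F: pair_graph F by fact
    interpret G: pair_graph G by fact
    have "pair_wf_digraph ?H"
      by unfold_locales (auto dest: F.in_arcsD1 F.in_arcsD2)
    then have "subgraph (with_proj ?H) (with_proj G)"
      using f G.wf_digraph_axioms by (auto simp: subgraph_def compatible_def wf_digraph_wp_iff)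
    moreover have "graph_iso F ?H"
      using f by (auto simp: graph_iso_iff[OF F] bij_betw_def)
    ultimately show ?L by blast
  qed
  then show ?thesis by (simp add: graph_free_def)
qed

lemma pair_graph_path_graph:
  assumes "distinct p"
  shows "pair_graph (path_graph p)"
proof -
  have "u \<in> set p \<and> v \<in> set p \<and> u \<noteq> v" if uv: "(u, v) \<in> set (zip p (tl p))" for u v
  proof -
    obtain i where i: "i < length p - 1" "u = p ! i" "v = tl p ! i"
      using uv by (auto simp: in_set_zip)
    then have "v = p ! Suc i" by (simp add: nth_tl)
    moreover have "i < length p" "Suc i < length p" using i by auto
    ultimately show ?thesis using assms i(2) by (metis n_not_Suc_n nth_eq_iff_index_eq nth_mem)
  qed
  then show ?thesis
    by (auto simp: pair_graph_iff path_graph_def symcl_def sym_def irrefl_def)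
qed

lemma pair_graph_theta_graph: "pair_graph (theta_graph l1 l2 l3)"
proof -
  have "pair_graph (path_graph (theta_path i l))" for i l
    by (rule pair_graph_path_graph) (auto simp: theta_path_def distinct_map inj_on_def)
  then show ?thesis
    unfolding pair_graph_iff theta_graph_def graph_union_def
    by (auto intro!: sym_Un simp: irrefl_def)
qed

lemma theta_graph_1_3_3:
  "theta_graph 1 3 3 = \<lparr>
     pverts = {Source, Sink, Internal 2 1, Internal 2 2, Internal 3 1, Internal 3 2},
     parcs = {(Source, Sink),
       (Source, Internal 2 1), (Internal 2 1, Internal 2 2), (Internal 2 2, Sink),
       (Source, Internal 3 1), (Internal 3 1, Internal 3 2), (Internal 3 2, Sink)}\<^sup>s\<rparr>"
  by (auto simp: theta_graph_def graph_union_def path_graph_def theta_path_def symcl_def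
      upt_rec numeral_eq_Suc)

lemma pair_graph_graph_join:
  assumes "pair_graph G" "pair_graph H"
  shows "pair_graph (graph_join G H)"
  using assms unfolding pair_graph_iff graph_join_def
  by (auto simp: sym_def irrefl_def symcl_def)

lemma pair_graph_complete_graph: "pair_graph (complete_graph n)"
  by (auto simp: pair_graph_iff complete_graph_def sym_def irrefl_def)

lemma pair_graph_empty_graph: "pair_graph (empty_graph t)"
  by (auto simp: pair_graph_iff empty_graph_def sym_def irrefl_def)

end

theory Submission
  imports Defs
begin

text \<open>
  The graph \<open>\<theta>\<^bsub>1,3,3\<^esub>\<close> is the \<open>domino\<close>: two 4-cycles that share an edge. Let \<open>G\<close> be domino-free
  with \<open>m\<close> edges and let \<open>l\<close> be its spectral radius. Suppose that \<open>l \<ge> (1 + sqrt (4 m - 3)) / 2\<close>,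
  that is, \<open>l\<^sup>2 - l \<ge> m - 1\<close>; as \<open>m \<ge> 43\<close>, this gives \<open>l \<ge> 7\<close>. It suffices to show that then
  \<open>l\<^sup>2 - l = m - 1\<close> and that \<open>G\<close> is a \<open>book\<close>, the join of an edge and an independent set; a book
  attains the bound, since it has an explicit eigenvector with two distinct entries.

  The moduli of the entries of an eigenvector for \<open>l\<close> form a nonnegative vertex weighting \<open>x\<close> with
  \<open>l x \<le> A x\<close>, where \<open>A\<close> is the adjacency matrix. This inequality replaces the Perron vector
  throughout. By \<open>ex_weighting\<close> the support of \<open>x\<close> may be taken closed under adjacency and the
  maximum of \<open>x\<close> to be \<open>1\<close>, attained at a vertex \<open>u\<close>.

  Let \<open>N\<close> be the neighbourhood of \<open>u\<close> and \<open>W\<close> the set of vertices other than \<open>u\<close> outside it, and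
  write \<open>d\<close> for the degree into \<open>N\<close>. Bounding \<open>(l - 1) l x(u)\<close> by walks of length two from \<open>u\<close>, and
  counting the \<open>m\<close> edges by their position relative to \<open>u\<close>, \<open>N\<close> and \<open>W\<close>, gives (\<open>slack\<close>)

    \<open>0 \<le> l\<^sup>2 - l - (m - 1) \<le> 1 + \<Sum>\<^bsub>v \<in> N\<^esub> ((d(v) - 1) x(v) - d(v) / 2) - \<Sum>\<^bsub>w \<in> W\<^esub> penalty(w)\<close>

  with \<open>penalty \<ge> 0\<close>. So everything depends on the graph induced on \<open>N\<close>. Domino-freeness makes it
  \<open>P\<^sub>5\<close>-free and turns each of its 4-cycles into the vertex set of a component; its components are
  therefore stars, double stars, stars with one additional edge, and graphs on four vertices. Instead
  of classifying components, the sum over \<open>N\<close> is rearranged into vertex charges \<open>\<phi>\<close> such that the sum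
  over every component stays the same and each charge can be bounded locally: an edge between a leaf
  and a vertex of degree at least two is charged to the latter, every other edge half to each end.
  Only vertices on a cycle in \<open>N\<close> (the set \<open>Q\<close>) can have a large charge. But, except for the centre of a
  star with an additional edge, they have at most three neighbours in \<open>N\<close>, hence small weight because
  \<open>l \<ge> 7\<close>, unless they have many neighbours in \<open>W\<close>, which costs more in penalties (\<open>penalty_lower\<close>)
  than is gained in weight. It turns out that one cycle already pushes the total below \<open>-1\<close>, so \<open>N\<close>
  induces a forest (\<open>Q_empty\<close>).

  In a forest every star with an edge and every double star has total charge at most \<open>-1\<close>, and every
  isolated vertex has negative charge. The weights in \<open>N\<close> sum to at least \<open>l\<close>, which excludes that
  \<open>N\<close> induces at most one edge. Hence it induces one star or one double star, all inequalities are
  equalities, and the centres have weight \<open>1\<close> (\<open>centre\<close>). Equality also forces \<open>W\<close> to be empty (\<open>W_empty\<close>). So \<open>u\<close> is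
  adjacent to all other vertices; a centre \<open>c\<close> has weight \<open>1\<close> too, so the same holds for \<open>c\<close>, which
  excludes the double star and leaves the book (\<open>extremal_structure\<close>).
\<close>

section \<open>Neighbourhoods in domino-free graphs\<close>

locale domino_free_graph =
  fixes V :: "'a set" and E :: "('a \<times> 'a) set"
  assumes finite_V: "finite V"
    and arcs: "E \<subseteq> V \<times> V"
    and adj_sym: "(v, w) \<in> E \<Longrightarrow> (w, v) \<in> E"
    and adj_irrefl: "(v, v) \<notin> E"
    and no_domino: "\<lbrakk>distinct [s, t, a, b, c, d]; (s, t) \<in> E; (s, a) \<in> E; (a, b) \<in> E; (b, t) \<in> E;
      (s, c) \<in> E; (c, d) \<in> E; (d, t) \<in> E\<rbrakk> \<Longrightarrow> False"
begin

definition nb :: "'a set \<Rightarrow> 'a \<Rightarrow> 'a set" where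
  "nb S v = {w \<in> S. (v, w) \<in> E}"

abbreviation deg :: "'a set \<Rightarrow> 'a \<Rightarrow> nat" where
  "deg S v \<equiv> card (nb S v)"

lemma finite_nb: "finite S \<Longrightarrow> finite (nb S v)"
  by (simp add: nb_def)

lemma sum_nb_swap:
  fixes f :: "'a \<Rightarrow> 'a \<Rightarrow> real"
  assumes "finite S" "finite T"
  shows "(\<Sum>v\<in>S. \<Sum>w\<in>nb T v. f v w) = (\<Sum>w\<in>T. \<Sum>v\<in>nb S w. f v w)"
proof -
  have "nb S w = {v \<in> S. (v, w) \<in> E}" for w
    using adj_sym by (auto simp: nb_def)
  then show ?thesis
    unfolding nb_def[of T] using sum.swap_restrict[OF assms, of f "\<lambda>v w. (v, w) \<in> E"] by simp
qed

lemma card_arcs: "card E = (\<Sum>v\<in>V. deg V v)"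
proof -
  have "E = Sigma V (nb V)" using arcs by (auto simp: nb_def)
  then have "card E = card (Sigma V (nb V))" by (rule arg_cong)
  also have "\<dots> = (\<Sum>v\<in>V. deg V v)" using finite_V by (intro card_SigmaI) (auto intro: finite_nb)
  finally show ?thesis .
qed

lemma nb_mono: "S \<subseteq> T \<Longrightarrow> nb S v \<subseteq> nb T v"
  by (auto simp: nb_def)

lemma deg_mono: "finite T \<Longrightarrow> S \<subseteq> T \<Longrightarrow> deg S v \<le> deg T v"
  by (intro card_mono finite_nb nb_mono)

lemma ex_nb_avoiding:
  assumes "card A < deg S v" "finite A"
  obtains w where "w \<in> S" "(v, w) \<in> E" "w \<notin> A"
proof -
  have "\<not> nb S v \<subseteq> A" using assms card_mono[of A "nb S v"] by auto
  then show ?thesis using that by (auto simp: nb_def)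
qed

lemma two_le_deg:
  assumes "finite S" "a \<in> S" "b \<in> S" "a \<noteq> b" "(v, a) \<in> E" "(v, b) \<in> E"
  shows "2 \<le> deg S v"
proof -
  have "{a, b} \<subseteq> nb S v" using assms by (auto simp: nb_def)
  from card_mono[OF finite_nb[OF assms(1)] this] show ?thesis using assms(4) by simp
qed

end

section \<open>The slack inequality at a vertex of maximal weight\<close>

text \<open>
  The situation in which the spectral radius reaches the bound: \<open>card E / 2\<close> is the number \<open>m\<close> of edges,
  so \<open>l_large\<close> reads \<open>l\<^sup>2 - l \<ge> m - 1\<close>.
\<close>

locale weighted_graph = domino_free_graph +
  fixes x :: "'a \<Rightarrow> real" and l :: real
  assumes x_nonneg: "0 \<le> x v"
    and x_le_1: "v \<in> V \<Longrightarrow> x v \<le> 1"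
    and x_pos: "(v, w) \<in> E \<Longrightarrow> 0 < x v \<Longrightarrow> 0 < x w"
    and subinvariant: "v \<in> V \<Longrightarrow> l * x v \<le> (\<Sum>w\<in>nb V v. x w)"
    and l_ge_7: "7 \<le> l"
    and l_large: "real (card E) / 2 - 1 \<le> l\<^sup>2 - l"
    and not_isolated: "v \<in> V \<Longrightarrow> \<exists>w. (v, w) \<in> E"

locale peak = weighted_graph +
  fixes u :: 'a
  assumes u_in_V: "u \<in> V" and x_u: "x u = 1"
begin

text \<open>
  \<open>M\<close> consists of the vertices that are neither leaves nor isolated in the graph induced on \<open>N\<close>. The
  centre of a star with at least two leaves has no neighbour in \<open>M\<close>, each centre of a double star has
  one. The vertices of \<open>Q\<close> are those on a cycle within \<open>N\<close>, see \<open>Q_cycle\<close>.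
\<close>

definition "N = nb V u"
definition "W = V - N - {u}"
definition "M = {v \<in> N. 2 \<le> deg N v}"
definition "Q = {v \<in> N. 2 \<le> deg M v}"

text \<open>
  The edge charge subtracted from \<open>(deg N v - 1) * x v\<close> counts each edge \<open>vw\<close> inside \<open>N\<close>
  with the factor \<open>1 / 2 + (of_bool (v \<in> M) - of_bool (w \<in> M)) / 2\<close>; the factors of the two ends of
  an edge sum to \<open>1\<close>.
\<close>

definition \<phi> :: "'a \<Rightarrow> real" where
  "\<phi> v = (real (deg N v) - 1) * x v - deg N v / 2 * (1 + of_bool (v \<in> M)) + deg M v / 2"

text \<open>
  The loss in the two-step bound at \<open>w \<in> W\<close>: edges between \<open>N\<close> and \<open>w\<close> contribute only \<open>x w\<close> instead of
  \<open>1\<close> each, and edges inside \<open>W\<close> contribute nothing; half of the latter are assigned to each end.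
\<close>

definition penalty :: "'a \<Rightarrow> real" where
  "penalty w = deg N w * (1 - x w) + deg W w / 2"

lemma M_subset: "M \<subseteq> N" and Q_subset_N: "Q \<subseteq> N" and N_subset: "N \<subseteq> V" and W_subset: "W \<subseteq> V"
  by (auto simp: M_def Q_def N_def W_def nb_def)

lemma finite_N: "finite N" and finite_W: "finite W" and finite_M: "finite M" and finite_Q: "finite Q"
  using finite_V M_subset Q_subset_N N_subset W_subset by (meson finite_subset)+

lemma u_notin: "u \<notin> N" "u \<notin> W"
  using adj_irrefl by (auto simp: N_def W_def nb_def)

lemma in_N: "v \<in> N \<longleftrightarrow> (u, v) \<in> E"
  using arcs by (auto simp: N_def nb_def)

lemma Q_subset_M: "Q \<subseteq> M"
  using deg_mono[OF finite_N M_subset] by (auto simp: Q_def M_def intro: order_trans)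

lemma V_eq: "V = insert u (N \<union> W)"
  using N_subset u_in_V by (auto simp: W_def)

lemma nb_V_N:
  assumes "v \<in> N"
  shows "nb V v = insert u (nb N v \<union> nb W v)"
  using assms adj_sym N_subset u_in_V by (auto simp: nb_def in_N W_def)

lemma nb_V_W:
  assumes "w \<in> W"
  shows "nb V w = nb N w \<union> nb W w"
  using assms adj_sym N_subset by (auto simp: nb_def in_N W_def)

lemma sum_nb_V_N:
  fixes f :: "'a \<Rightarrow> real"
  assumes "v \<in> N"
  shows "sum f (nb V v) = f u + sum f (nb N v) + sum f (nb W v)"
proof -
  have "u \<notin> nb N v \<union> nb W v" "nb N v \<inter> nb W v = {}"
    using u_notin by (auto simp: nb_def W_def)
  then show ?thesis
    unfolding nb_V_N[OF assms] by (simp add: finite_nb finite_N finite_W sum.union_disjoint)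
qed

lemma sum_nb_V_W:
  fixes f :: "'a \<Rightarrow> real"
  assumes "w \<in> W"
  shows "sum f (nb V w) = sum f (nb N w) + sum f (nb W w)"
proof -
  have "nb N w \<inter> nb W w = {}"
    by (auto simp: nb_def W_def)
  then show ?thesis
    unfolding nb_V_W[OF assms] by (simp add: finite_nb finite_N finite_W sum.union_disjoint)
qed

lemma sum_V:
  fixes f :: "'a \<Rightarrow> real"
  shows "sum f V = f u + sum f N + sum f W"
proof -
  have "sum f V = sum f (insert u (N \<union> W))" by (rule arg_cong[OF V_eq])
  moreover
  have "u \<notin> N \<union> W" "N \<inter> W = {}" using u_notin by (auto simp: W_def)
  ultimately show ?thesis by (simp add: finite_N finite_W sum.union_disjoint)
qed

lemma count_arcs:
  "real (card E) / 2 = real (card N) + (\<Sum>v\<in>N. real (deg N v)) / 2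
    + (\<Sum>w\<in>W. real (deg N w)) + (\<Sum>w\<in>W. real (deg W w)) / 2"
proof -
  have "real (card E) = (\<Sum>v\<in>V. \<Sum>w\<in>nb V v. 1)"
    by (simp add: card_arcs)
  also have "\<dots> = real (card N) + (\<Sum>v\<in>N. \<Sum>w\<in>nb V v. 1) + (\<Sum>v\<in>W. \<Sum>w\<in>nb V v. 1)"
    unfolding sum_V by (simp add: N_def)
  also have "(\<Sum>v\<in>N. \<Sum>w\<in>nb V v. (1::real)) = (\<Sum>v\<in>N. 1 + real (deg N v) + deg W v)"
    by (intro sum.cong refl) (simp add: sum_nb_V_N del: sum_constant, simp)
  also have "\<dots> = real (card N) + (\<Sum>v\<in>N. real (deg N v)) + (\<Sum>v\<in>N. \<Sum>w\<in>nb W v. 1)"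
    by (simp add: sum.distrib)
  also have "(\<Sum>v\<in>N. \<Sum>w\<in>nb W v. (1::real)) = (\<Sum>w\<in>W. \<Sum>v\<in>nb N w. 1)"
    by (rule sum_nb_swap[OF finite_N finite_W])
  also have "(\<Sum>v\<in>W. \<Sum>w\<in>nb V v. (1::real)) = (\<Sum>v\<in>W. real (deg N v) + deg W v)"
    by (intro sum.cong refl) (simp add: sum_nb_V_W del: sum_constant, simp)
  finally show ?thesis by (simp add: sum.distrib)
qed

text \<open>
  Subtracting \<open>l\<close> via \<open>(l - 1) * (l * x u) \<le> (l - 1) * sum x N\<close>, instead of estimating \<open>l\<^sup>2\<close> and
  \<open>l\<close> separately, makes the inequality \<open>l x \<le> A x\<close> sufficient: \<open>x\<close> is never bounded from below by the
  weights of its neighbours.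
\<close>

lemma two_step_bound:
  "l\<^sup>2 - l \<le> card N + (\<Sum>v\<in>N. (real (deg N v) - 1) * x v) + (\<Sum>w\<in>W. deg N w * x w)"
proof -
  have "(l - 1) * (l * x u) \<le> (l - 1) * (\<Sum>v\<in>N. x v)"
    using subinvariant[OF u_in_V] l_ge_7 by (intro mult_left_mono) (auto simp: N_def)
  then have "l\<^sup>2 - l \<le> (\<Sum>v\<in>N. l * x v - x v)"
    by (simp add: x_u power2_eq_square algebra_simps sum_distrib_left sum_subtractf)
  also have "\<dots> \<le> (\<Sum>v\<in>N. sum x (nb V v) - x v)"
    using subinvariant N_subset by (intro sum_mono) auto
  also have "\<dots> = (\<Sum>v\<in>N. 1 + sum x (nb N v) + sum x (nb W v) - x v)"
    by (intro sum.cong) (simp_all add: sum_nb_V_N x_u)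
  also have "\<dots> = card N + (\<Sum>v\<in>N. sum x (nb N v)) + (\<Sum>v\<in>N. sum x (nb W v)) - sum x N"
    by (simp add: sum.distrib sum_subtractf)
  also have "(\<Sum>v\<in>N. sum x (nb N v)) = (\<Sum>w\<in>N. \<Sum>v\<in>nb N w. x w)"
    by (rule sum_nb_swap[OF finite_N finite_N])
  also have "(\<Sum>v\<in>N. sum x (nb W v)) = (\<Sum>w\<in>W. \<Sum>v\<in>nb N w. x w)"
    by (rule sum_nb_swap[OF finite_N finite_W])
  finally show ?thesis
    by (simp add: algebra_simps sum_subtractf)
qed

lemma sum_\<phi>:
  "(\<Sum>v\<in>N. \<phi> v) = (\<Sum>v\<in>N. (real (deg N v) - 1) * x v) - (\<Sum>v\<in>N. real (deg N v)) / 2"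
proof -
  have "(\<Sum>v\<in>N. real (deg M v)) = (\<Sum>v\<in>N. \<Sum>w\<in>nb M v. 1)" by simp
  also have "\<dots> = (\<Sum>w\<in>M. \<Sum>v\<in>nb N w. 1)" by (rule sum_nb_swap[OF finite_N finite_M])
  also have "\<dots> = (\<Sum>w\<in>M. real (deg N w))" by simp
  also have "\<dots> = (\<Sum>w\<in>N. real (deg N w) * of_bool (w \<in> M))"
    using M_subset by (intro sum.mono_neutral_cong_left finite_N) auto
  finally show ?thesis
    unfolding \<phi>_def by (simp add: sum.distrib sum_subtractf algebra_simps flip: sum_divide_distrib)
qed

lemma slack:
  "l\<^sup>2 - l - (real (card E) / 2 - 1) \<le> 1 + (\<Sum>v\<in>N. \<phi> v) - (\<Sum>w\<in>W. penalty w)"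
proof -
  have "(\<Sum>w\<in>W. penalty w) =
      (\<Sum>w\<in>W. real (deg N w)) - (\<Sum>w\<in>W. deg N w * x w) + (\<Sum>w\<in>W. real (deg W w)) / 2"
    unfolding penalty_def
    by (simp add: sum.distrib sum_subtractf algebra_simps flip: sum_divide_distrib)
  then show ?thesis
    using two_step_bound count_arcs unfolding sum_\<phi> by linarith
qed

section \<open>Cycles among the neighbours\<close>

text \<open>
  Otherwise \<open>uc\<close> is the common edge of the two 4-cycles \<open>u a b c\<close> and \<open>u e d c\<close>.
\<close>

lemma no_P5:
  assumes "distinct [a, b, c, d, e]" "{a, b, c, d, e} \<subseteq> N"
    "(a, b) \<in> E" "(b, c) \<in> E" "(c, d) \<in> E" "(d, e) \<in> E"
  shows False
  using assms u_notin by (intro no_domino[of u c a b e d]) (auto simp: in_N intro: adj_sym)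

text \<open>
  A further neighbour \<open>z\<close> of \<open>a\<close> would give a domino with common edge \<open>ab\<close>: one 4-cycle is the given
  one and the other is \<open>b u z a\<close>.
\<close>

lemma C4_closed:
  assumes "distinct [a, b, c, d]" "{a, b, c, d} \<subseteq> N"
    "(a, b) \<in> E" "(b, c) \<in> E" "(c, d) \<in> E" "(d, a) \<in> E"
  shows "nb N a \<subseteq> {b, c, d}"
proof (rule ccontr)
  assume "\<not> nb N a \<subseteq> {b, c, d}"
  then obtain z where z: "z \<in> N" "(a, z) \<in> E" "z \<notin> {b, c, d}" by (auto simp: nb_def)
  then have "z \<noteq> a" using adj_irrefl by auto
  with z assms u_notin show False
    by (intro no_domino[of b a c d u z]) (auto simp: in_N intro: adj_sym)
qed

text \<open>
  A neighbour \<open>z\<close> of \<open>w\<close> elsewhere in \<open>N\<close> would give a domino with common edge \<open>uv\<close>, formed by the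
  4-cycles \<open>u z w v\<close> and \<open>u c b v\<close>.
\<close>

lemma nb_outside_P3:
  assumes "w \<in> W" "{v, b, c} \<subseteq> N" "v \<noteq> c" "(v, b) \<in> E" "(b, c) \<in> E" "(w, v) \<in> E"
  shows "nb N w \<subseteq> {v, b, c}"
proof (rule ccontr)
  assume "\<not> nb N w \<subseteq> {v, b, c}"
  then obtain z where z: "z \<in> N" "(w, z) \<in> E" "z \<notin> {v, b, c}" by (auto simp: nb_def)
  have "v \<noteq> b" "b \<noteq> c" using assms adj_irrefl by auto
  moreover have "w \<notin> N" "w \<noteq> u" using assms(1) by (auto simp: W_def)
  ultimately show False using z assms u_notin
    by (intro no_domino[of u v z w c b]) (auto simp: in_N intro: adj_sym)
qed

lemma deg_outside_le_3:
  assumes "w \<in> W" "v \<in> N" "(w, v) \<in> E" "b \<in> M" "(v, b) \<in> E"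
  shows "deg N w \<le> 3"
proof -
  have "card {v} < deg N b" using assms(4) by (auto simp: M_def)
  then obtain c where c: "c \<in> N" "(b, c) \<in> E" "c \<notin> {v}" by (rule ex_nb_avoiding) simp
  have "nb N w \<subseteq> {v, b, c}"
    using assms c M_subset by (intro nb_outside_P3) auto
  then have "deg N w \<le> card {v, b, c}" by (intro card_mono) auto
  also have "\<dots> \<le> 3" by (simp add: card_insert_if)
  finally show ?thesis .
qed

lemma penalty_nonneg: "w \<in> W \<Longrightarrow> 0 \<le> penalty w"
  using x_le_1[of w] W_subset by (auto simp: penalty_def)

lemma weight_bound:
  assumes "v \<in> V"
  shows "7 * x v \<le> deg V v"
proof -
  have "7 * x v \<le> l * x v" using l_ge_7 x_nonneg by (intro mult_right_mono) auto
  also have "\<dots> \<le> (\<Sum>w\<in>nb V v. x w)" using subinvariant assms by simp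
  also have "\<dots> \<le> (\<Sum>w\<in>nb V v. 1)" using x_le_1 by (intro sum_mono) (auto simp: nb_def)
  finally show ?thesis by simp
qed

lemma weight_bound_N: "v \<in> N \<Longrightarrow> 7 * x v \<le> 1 + real (deg N v) + deg W v"
  using weight_bound[of v] sum_nb_V_N[of v "\<lambda>_. 1"] N_subset by auto

text \<open>
  If \<open>w\<close> has a neighbour in \<open>Q\<close>, then \<open>j = deg N w\<close> is at most \<open>3\<close>. With \<open>k = deg W w\<close>, the weight bound
  \<open>x w \<le> (j + k) / 7\<close> gives \<open>penalty w \<ge> j (1 - j / 7) + k (1 / 2 - j / 7)\<close>, and here the second
  summand is nonnegative and the first is at least \<open>4 / 7 * j\<close>.
\<close>

lemma penalty_lower:
  assumes "w \<in> W"
  shows "4 / 7 * deg Q w \<le> penalty w"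
proof (cases "nb Q w = {}")
  case True
  then show ?thesis using penalty_nonneg[OF assms] by simp
next
  case False
  then obtain v where v: "v \<in> Q" "(w, v) \<in> E" by (auto simp: nb_def)
  then have "card {} < deg M v" by (simp add: Q_def)
  then obtain b where "b \<in> M" "(v, b) \<in> E" by (rule ex_nb_avoiding) auto
  then have 3: "deg N w \<le> 3"
    using deg_outside_le_3[OF assms _ v(2)] v(1) Q_subset_N by auto
  define j k where "j = real (deg N w)" and "k = real (deg W w)"
  have "7 * x w \<le> j + k"
    using weight_bound[of w] sum_nb_V_W[OF assms, of "\<lambda>_. 1"] assms W_subset
    by (auto simp: j_def k_def)
  moreover have j: "0 \<le> j" "j \<le> 3" "0 \<le> k" using 3 by (auto simp: j_def k_def)
  ultimately have "j * x w \<le> j * ((j + k) / 7)" by (intro mult_left_mono) auto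
  moreover have "0 \<le> j * (3 - j)" "0 \<le> k * (3 - j)" using j by simp_all
  ultimately have "4 / 7 * j \<le> penalty w"
    unfolding penalty_def j_def[symmetric] k_def[symmetric] using j by (simp add: algebra_simps)
  moreover have "deg Q w \<le> deg N w" by (rule deg_mono[OF finite_N Q_subset_N])
  ultimately show ?thesis by (simp add: j_def)
qed

text \<open>
  The charge after the penalties from \<open>penalty_lower\<close> have been passed on to the vertices of \<open>Q\<close>. Each
  neighbour in \<open>W\<close> raises the bound on the weight of \<open>v\<close> by \<open>1 / 7\<close>, and so \<open>\<phi> v\<close> by at most \<open>2 / 7\<close>
  if \<open>deg N v \<le> 3\<close>; the deduction of \<open>4 / 7\<close> outweighs that.
\<close>

definition \<psi> :: "'a \<Rightarrow> real" where
  "\<psi> v = \<phi> v - (if v \<in> Q then 4 / 7 * deg W v else 0)"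

lemma sum_\<psi>: "-1 \<le> (\<Sum>v\<in>N. \<psi> v)"
proof -
  have "(\<Sum>v\<in>N. if v \<in> Q then 4 / 7 * real (deg W v) else 0) = (\<Sum>v\<in>Q. 4 / 7 * real (deg W v))"
    using Q_subset_N by (intro sum.mono_neutral_cong_right finite_N) auto
  also have "\<dots> = (\<Sum>v\<in>Q. \<Sum>w\<in>nb W v. 4 / 7)" by (simp add: mult.commute)
  also have "\<dots> = (\<Sum>w\<in>W. \<Sum>v\<in>nb Q w. 4 / 7)" by (rule sum_nb_swap[OF finite_Q finite_W])
  also have "\<dots> = (\<Sum>w\<in>W. 4 / 7 * deg Q w)" by (simp add: mult.commute)
  also have "\<dots> \<le> (\<Sum>w\<in>W. penalty w)" by (intro sum_mono penalty_lower)
  finally show ?thesis using slack l_large unfolding \<psi>_def sum_subtractf by simp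
qed

lemma \<psi>_deg_2:
  assumes "v \<in> Q" "deg N v \<le> 2"
  shows "\<psi> v \<le> - 4 / 7"
proof -
  have "deg N v = 2" "v \<in> M" "v \<in> N" using assms Q_subset_M by (auto simp: M_def)
  moreover have "deg M v \<le> deg N v" by (rule deg_mono[OF finite_N M_subset])
  ultimately show ?thesis using weight_bound_N[of v] assms(1) by (simp add: \<psi>_def \<phi>_def)
qed

lemma \<psi>_deg_3:
  assumes "v \<in> Q" "deg N v \<le> 3"
  shows "\<psi> v \<le> - 5 / 14"
proof (cases "deg N v \<le> 2")
  case True
  then show ?thesis using \<psi>_deg_2[OF assms(1)] by simp
next
  case False
  then have "deg N v = 3" "v \<in> M" "v \<in> N" using assms Q_subset_M by (auto simp: M_def)
  moreover have "deg M v \<le> deg N v" by (rule deg_mono[OF finite_N M_subset])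
  ultimately show ?thesis using weight_bound_N[of v] assms(1) by (simp add: \<psi>_def \<phi>_def)
qed

lemma C4_member:
  assumes "distinct [a, b, c, d]" "{a, b, c, d} \<subseteq> N"
    "(a, b) \<in> E" "(b, c) \<in> E" "(c, d) \<in> E" "(d, a) \<in> E"
  shows "a \<in> Q" "deg N a \<le> 3"
proof -
  have M: "b \<in> M" "d \<in> M"
    using assms two_le_deg[OF finite_N, of a c b] two_le_deg[OF finite_N, of a c d]
    by (auto simp: M_def intro: adj_sym)
  then show "a \<in> Q"
    using assms two_le_deg[OF finite_M, of b d a] by (auto simp: Q_def intro: adj_sym)
  have "deg N a \<le> card {b, c, d}"
    using C4_closed[OF assms] by (intro card_mono) auto
  also have "\<dots> \<le> 3" by (simp add: card_insert_if)
  finally show "deg N a \<le> 3" .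
qed

lemma triangle_member:
  assumes "{a, b, c} \<subseteq> N" "(a, b) \<in> E" "(b, c) \<in> E" "(c, a) \<in> E"
  shows "a \<in> Q"
proof -
  have "a \<noteq> b" "b \<noteq> c" "c \<noteq> a" using assms adj_irrefl by auto
  moreover from this have "b \<in> M" "c \<in> M"
    using assms two_le_deg[OF finite_N, of a c b] two_le_deg[OF finite_N, of a b c]
    by (auto simp: M_def intro: adj_sym)
  ultimately show ?thesis
    using assms two_le_deg[OF finite_M, of b c a] by (auto simp: Q_def intro: adj_sym)
qed

text \<open>
  Further neighbours of \<open>a\<close> and \<open>b\<close> must coincide, as \<open>a' a c b b'\<close> would be a \<open>P\<^sub>5\<close> otherwise. Then
  all three vertices lie on the 4-cycle \<open>a c b a'\<close>.
\<close>

lemma triangle_two_large: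
  assumes "{a, b, c} \<subseteq> N" "(a, b) \<in> E" "(b, c) \<in> E" "(c, a) \<in> E" "2 < deg N a" "2 < deg N b"
  shows "deg N a \<le> 3 \<and> deg N b \<le> 3 \<and> deg N c \<le> 3"
proof -
  have neq: "a \<noteq> b" "b \<noteq> c" "c \<noteq> a" using assms adj_irrefl by auto
  obtain a' where a': "a' \<in> N" "(a, a') \<in> E" "a' \<notin> {b, c}"
    by (rule ex_nb_avoiding[of "{b, c}" N a]) (use assms neq in auto)
  obtain b' where b': "b' \<in> N" "(b, b') \<in> E" "b' \<notin> {a, c}"
    by (rule ex_nb_avoiding[of "{a, c}" N b]) (use assms neq in auto)
  have "a' \<noteq> a" "b' \<noteq> b" using a' b' adj_irrefl by auto
  have "a' = b'"
  proof (rule ccontr)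
    assume "a' \<noteq> b'"
    then show False
      using no_P5[of a' a c b b'] a' b' \<open>a' \<noteq> a\<close> \<open>b' \<noteq> b\<close> assms neq by (auto intro: adj_sym)
  qed
  then show ?thesis
    using C4_member(2)[of a c b a'] C4_member(2)[of b a' a c] C4_member(2)[of c b a' a]
      a' b' \<open>a' \<noteq> a\<close> \<open>b' \<noteq> b\<close> assms neq by (auto intro: adj_sym)
qed

text \<open>
  Two neighbours \<open>p\<close> and \<open>r\<close> of \<open>q\<close> in \<open>M\<close> have further neighbours \<open>p'\<close> and \<open>r'\<close>. Unless these close a
  triangle or a 4-cycle, \<open>p' p q r r'\<close> is a \<open>P\<^sub>5\<close>.
\<close>

lemma Q_cycle:
  assumes "q \<in> Q"
  obtains (triangle) p r where "{q, p, r} \<subseteq> N" "(q, p) \<in> E" "(p, r) \<in> E" "(r, q) \<in> E"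
  | (C4) p s r where "distinct [q, p, s, r]" "{q, p, s, r} \<subseteq> N"
      "(q, p) \<in> E" "(p, s) \<in> E" "(s, r) \<in> E" "(r, q) \<in> E"
proof -
  have q: "q \<in> N" "2 \<le> deg M q" using assms by (auto simp: Q_def)
  obtain p where p: "p \<in> M" "(q, p) \<in> E"
    by (rule ex_nb_avoiding[of "{}" M q]) (use q in auto)
  obtain r where r: "r \<in> M" "(q, r) \<in> E" "r \<notin> {p}"
    by (rule ex_nb_avoiding[of "{p}" M q]) (use q in auto)
  obtain p' where p': "p' \<in> N" "(p, p') \<in> E" "p' \<notin> {q}"
    by (rule ex_nb_avoiding[of "{q}" N p]) (use p in \<open>auto simp: M_def\<close>)
  obtain r' where r': "r' \<in> N" "(r, r') \<in> E" "r' \<notin> {q}"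
    by (rule ex_nb_avoiding[of "{q}" N r]) (use r in \<open>auto simp: M_def\<close>)
  have neq: "p \<noteq> q" "r \<noteq> q" "p' \<noteq> p" "r' \<noteq> r" using p r p' r' adj_irrefl by auto
  have N: "p \<in> N" "r \<in> N" using p r M_subset by auto
  consider "(p, r) \<in> E" | "(p, r) \<notin> E" "p' = r'" | "(p, r) \<notin> E" "p' \<noteq> r'" by blast
  then show ?thesis
  proof cases
    case 1
    then show ?thesis using p r q N by (intro triangle) (auto intro: adj_sym)
  next
    case 2
    have "p' \<noteq> r" using 2 p' by auto
    then show ?thesis using 2 p r q N p' r' neq by (intro C4[of p p' r]) (auto intro: adj_sym)
  next
    case 3
    then have "p' \<noteq> r" "r' \<noteq> p" using p' r' by (auto intro: adj_sym)
    then show ?thesis using 3 no_P5[of p' p q r r'] p r q N p' r' neq by (auto intro: adj_sym)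
  qed
qed

text \<open>
  If \<open>deg N q > 3\<close>, then \<open>q\<close> lies on no 4-cycle in \<open>N\<close>, so it lies on a triangle, and the two other
  vertices of the triangle have no further neighbours in \<open>N\<close>. A third neighbour of \<open>q\<close> in \<open>M\<close> would
  then give a \<open>P\<^sub>5\<close> that ends with the triangle's vertices.
\<close>

lemma Q_degree:
  assumes "q \<in> Q"
  shows "deg M q \<le> 2 \<or> deg N q \<le> 3"
  using assms
proof (cases rule: Q_cycle)
  case (triangle p r)
  note t = this
  show ?thesis
  proof (rule ccontr)
    assume "\<not> ?thesis"
    then have large: "2 < deg M q" "3 < deg N q" by auto
    have neq: "p \<noteq> q" "p \<noteq> r" "r \<noteq> q" using t adj_irrefl by auto
    have "deg N p \<le> 2"
      using triangle_two_large[of q p r] t large by (cases "deg N p \<le> 2") auto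
    then have p: "(p, y) \<in> E \<Longrightarrow> y \<in> N \<Longrightarrow> y \<in> {q, r}" for y
      using card_seteq[of "nb N p" "{q, r}"] finite_nb[OF finite_N] t neq
      by (auto simp: nb_def intro: adj_sym)
    have "deg N r \<le> 2"
      using triangle_two_large[of q r p] t large by (cases "deg N r \<le> 2") (auto intro: adj_sym)
    then have r: "(r, y) \<in> E \<Longrightarrow> y \<in> N \<Longrightarrow> y \<in> {q, p}" for y
      using card_seteq[of "nb N r" "{q, p}"] finite_nb[OF finite_N] t neq
      by (auto simp: nb_def intro: adj_sym)
    obtain s where s: "s \<in> M" "(q, s) \<in> E" "s \<notin> {p, r}"
      by (rule ex_nb_avoiding[of "{p, r}" M q]) (use large neq in auto)
    obtain s' where s': "s' \<in> N" "(s, s') \<in> E" "s' \<notin> {q}"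
      by (rule ex_nb_avoiding[of "{q}" N s]) (use s in \<open>auto simp: M_def\<close>)
    have "s \<noteq> q" "s \<noteq> s'" "s \<in> N" using s s' adj_irrefl M_subset by auto
    moreover have "s' \<noteq> p" "s' \<noteq> r"
      using p[of s] r[of s] s s' \<open>s \<noteq> q\<close> \<open>s \<in> N\<close> by (auto dest: adj_sym)
    ultimately show False
      using no_P5[of s' s q p r] s s' t neq by (auto intro: adj_sym)
  qed
next
  case (C4 p s r)
  then show ?thesis using C4_member(2) by blast
qed

lemma \<psi>_nonpos:
  assumes "v \<in> N"
  shows "\<psi> v \<le> 0"
proof -
  have dM: "deg M v \<le> deg N v" by (rule deg_mono[OF finite_N M_subset])
  have x: "0 \<le> x v" "x v \<le> 1" using x_nonneg x_le_1 assms N_subset by auto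
  consider "v \<in> Q" "deg N v \<le> 3" | "v \<in> M" "deg M v \<le> 2" | "deg N v \<le> 1" "v \<notin> M" "v \<notin> Q"
    using Q_degree[of v] assms Q_subset_M by (force simp: M_def Q_def)
  then show ?thesis
  proof cases
    case 1
    then show ?thesis using \<psi>_deg_3[of v] by simp
  next
    case 2
    have "(real (deg N v) - 1) * x v \<le> (real (deg N v) - 1) * 1"
      using 2 x by (intro mult_left_mono) (auto simp: M_def)
    with 2 have "\<phi> v \<le> 0" by (simp add: \<phi>_def)
    then show ?thesis by (simp add: \<psi>_def)
  next
    case 3
    then have "deg N v = 0 \<or> deg N v = 1" by auto
    with 3 dM x show ?thesis by (auto simp: \<psi>_def \<phi>_def)
  qed
qed

text \<open>
  Since no vertex has positive \<open>\<psi>\<close>, a contradiction arises as soon as a few vertices have a total below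
  \<open>-1\<close>: two of degree two (\<open>-8 / 7\<close>) or three of degree at most three (\<open>-15 / 14\<close>).
\<close>

lemma sum_\<psi>_subset_ge:
  assumes "S \<subseteq> N"
  shows "-1 \<le> (\<Sum>v\<in>S. \<psi> v)"
proof -
  have "(\<Sum>v\<in>N. \<psi> v) = (\<Sum>v\<in>S. \<psi> v) + (\<Sum>v\<in>N - S. \<psi> v)"
    using sum.subset_diff[OF assms finite_N] by (simp add: add.commute)
  moreover have "(\<Sum>v\<in>N - S. \<psi> v) \<le> 0" by (intro sum_nonpos \<psi>_nonpos) auto
  ultimately show ?thesis using sum_\<psi> by linarith
qed

lemma not_two_of_deg_2:
  assumes "a \<in> Q" "b \<in> Q" "a \<noteq> b" "deg N a \<le> 2" "deg N b \<le> 2"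
  shows False
  using sum_\<psi>_subset_ge[of "{a, b}"] \<psi>_deg_2[of a] \<psi>_deg_2[of b] assms Q_subset_N by auto

lemma not_three_of_deg_3:
  assumes "a \<in> Q" "b \<in> Q" "c \<in> Q" "a \<noteq> b" "b \<noteq> c" "c \<noteq> a"
    "deg N a \<le> 3" "deg N b \<le> 3" "deg N c \<le> 3"
  shows False
proof -
  have "(\<Sum>v\<in>{a, b, c}. \<psi> v) = \<psi> a + \<psi> b + \<psi> c" using assms by auto
  then show False
    using sum_\<psi>_subset_ge[of "{a, b, c}"] \<psi>_deg_3[of a] \<psi>_deg_3[of b] \<psi>_deg_3[of c]
      assms Q_subset_N by auto
qed

text \<open>
  In a triangle, either two vertices have degree two in \<open>N\<close>, or two have larger degree, and then all
  three have degree at most three by \<open>triangle_two_large\<close>. All vertices of a 4-cycle have degree at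
  most three.
\<close>

lemma Q_empty: "Q = {}"
proof (rule ccontr)
  assume "Q \<noteq> {}"
  then obtain q where "q \<in> Q" by auto
  then show False
  proof (cases rule: Q_cycle)
    case (triangle p r)
    have neq: "q \<noteq> p" "p \<noteq> r" "r \<noteq> q" using triangle adj_irrefl by auto
    have Q: "q \<in> Q" "p \<in> Q" "r \<in> Q"
      using triangle triangle_member[of q p r] triangle_member[of p r q] triangle_member[of r q p]
      by auto
    have "deg N q \<le> 2 \<or> deg N p \<le> 2"
      using triangle_two_large[of q p r] not_three_of_deg_3[OF Q neq] triangle by force
    moreover have "deg N p \<le> 2 \<or> deg N r \<le> 2"
      using triangle_two_large[of p r q] not_three_of_deg_3[OF Q neq] triangle by force
    moreover have "deg N r \<le> 2 \<or> deg N q \<le> 2"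
      using triangle_two_large[of r q p] not_three_of_deg_3[OF Q neq] triangle by force
    ultimately show False
      using not_two_of_deg_2[OF Q(1,2) neq(1)] not_two_of_deg_2[OF Q(2,3) neq(2)]
        not_two_of_deg_2[OF Q(3,1) neq(3)]
      by blast
  next
    case (C4 p s r)
    then show False
      using C4_member[of q p s r] C4_member[of p s r q] C4_member[of s r q p]
        not_three_of_deg_3[of q p s] by auto
  qed
qed

section \<open>Stars, double stars and equality\<close>

lemma \<phi>_M_eq:
  assumes "v \<in> M"
  shows "\<phi> v = - 1 + deg M v / 2 - (real (deg N v) - 1) * (1 - x v)"
  using assms by (simp add: \<phi>_def algebra_simps)

lemma deg_M_le_1: "v \<in> N \<Longrightarrow> deg M v \<le> 1"
  using Q_empty by (fastforce simp: Q_def)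

lemma \<phi>_M:
  assumes "v \<in> M"
  shows "\<phi> v \<le> - 1 + deg M v / 2" "- 1 + deg M v / 2 \<le> \<phi> v \<Longrightarrow> x v = 1"
proof -
  have *: "1 \<le> real (deg N v) - 1" "0 \<le> 1 - x v"
    using assms x_le_1 M_subset N_subset by (auto simp: M_def)
  then have **: "1 * (1 - x v) \<le> (real (deg N v) - 1) * (1 - x v)"
    by (intro mult_right_mono) auto
  then show "\<phi> v \<le> - 1 + deg M v / 2" using * by (simp add: \<phi>_M_eq[OF assms])
  show "x v = 1" if "- 1 + deg M v / 2 \<le> \<phi> v"
    using that * ** by (simp add: \<phi>_M_eq[OF assms])
qed

lemma \<phi>_nonpos: "v \<in> N \<Longrightarrow> \<phi> v \<le> 0"
  using \<psi>_nonpos[of v] Q_empty by (simp add: \<psi>_def)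

lemma \<phi>_leaf_pair:
  assumes "v \<in> N" "v \<notin> M" "deg N v \<noteq> 0" "deg M v = 0"
  shows "\<phi> v = - 1 / 2"
proof -
  have "deg N v = 1" using assms by (auto simp: M_def)
  then show ?thesis using assms by (simp add: \<phi>_def)
qed

lemma x_N_pos: "v \<in> N \<Longrightarrow> 0 < x v"
  using x_pos[of u v] x_u by (simp add: in_N)

lemma \<phi>_zero:
  assumes "v \<in> N" "\<phi> v = 0"
  shows "v \<notin> M" "\<exists>z\<in>M. (v, z) \<in> E"
proof -
  show nM: "v \<notin> M"
    using \<phi>_M(1)[of v] deg_M_le_1[of v] assms by auto
  have "deg M v \<noteq> 0"
  proof
    assume M0: "deg M v = 0"
    show False
    proof (cases "deg N v = 0")
      case True
      then show False using assms nM M0 x_N_pos[of v] by (simp add: \<phi>_def)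
    next
      case False
      then show False using \<phi>_leaf_pair[OF assms(1) nM _ M0] assms(2) by simp
    qed
  qed
  then have "nb M v \<noteq> {}" by (auto simp: finite_nb finite_M)
  then show "\<exists>z\<in>M. (v, z) \<in> E" by (auto simp: nb_def)
qed

text \<open>
  Once some vertices use up the whole slack of \<open>1\<close>, every other term in \<open>slack\<close> vanishes.
\<close>

lemma tight:
  assumes "S \<subseteq> N" "(\<Sum>v\<in>S. \<phi> v) \<le> - 1"
  shows "(\<Sum>v\<in>S. \<phi> v) = - 1" "\<And>v. v \<in> N - S \<Longrightarrow> \<phi> v = 0" "\<And>w. w \<in> W \<Longrightarrow> penalty w = 0"
    "l\<^sup>2 - l = real (card E) / 2 - 1"
proof -
  have split: "(\<Sum>v\<in>N. \<phi> v) = (\<Sum>v\<in>S. \<phi> v) + (\<Sum>v\<in>N - S. \<phi> v)"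
    using sum.subset_diff[OF assms(1) finite_N] by (simp add: add.commute)
  have rest: "(\<Sum>v\<in>N - S. \<phi> v) \<le> 0" by (intro sum_nonpos \<phi>_nonpos) auto
  have pen: "0 \<le> (\<Sum>w\<in>W. penalty w)" by (intro sum_nonneg penalty_nonneg)
  note all = split rest pen slack l_large assms(2)
  show "(\<Sum>v\<in>S. \<phi> v) = - 1" "l\<^sup>2 - l = real (card E) / 2 - 1" using all by linarith+
  have "(\<Sum>v\<in>N - S. - \<phi> v) = 0" using all by (simp add: sum_negf)
  then show "\<phi> v = 0" if "v \<in> N - S" for v
    using that sum_nonneg_eq_0_iff[of "N - S" "\<lambda>v. - \<phi> v"] finite_N \<phi>_nonpos by auto
  have "(\<Sum>w\<in>W. penalty w) = 0" using all by linarith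
  then show "penalty w = 0" if "w \<in> W" for w
    using that sum_nonneg_eq_0_iff[of W penalty] finite_W penalty_nonneg by auto
qed

text \<open>
  Otherwise \<open>N\<close> induces a matching with isolated vertices. A single matching edge exhausts the slack,
  so \<open>N\<close> would consist of its two ends, or of isolated vertices only, whose charges are \<open>- x v\<close>. Both
  contradict that the weights in \<open>N\<close> sum to at least \<open>l \<ge> 7\<close>.
\<close>

lemma M_nonempty: "M \<noteq> {}"
proof
  assume M: "M = {}"
  then have M0: "deg M v = 0" for v by (simp add: nb_def)
  have "l * x u \<le> (\<Sum>v\<in>N. x v)" using subinvariant[OF u_in_V] by (simp add: N_def)
  then have big: "7 \<le> (\<Sum>v\<in>N. x v)" using l_ge_7 x_u by simp
  show False
  proof (cases "\<exists>v\<in>N. deg N v \<noteq> 0")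
    case True
    then obtain v where v: "v \<in> N" "deg N v \<noteq> 0" by auto
    then obtain z where z: "z \<in> N" "(v, z) \<in> E"
      using ex_nb_avoiding[of "{}" N v] by auto
    have "nb N z \<noteq> {}" using v z by (auto simp: nb_def intro: adj_sym)
    then have "deg N z \<noteq> 0" by (simp add: finite_nb finite_N)
    have "v \<noteq> z" using z adj_irrefl by auto
    then have "(\<Sum>v\<in>{v, z}. \<phi> v) \<le> - 1"
      using \<phi>_leaf_pair[of v] \<phi>_leaf_pair[of z] v z \<open>deg N z \<noteq> 0\<close> M M0 by simp
    then have "y \<in> {v, z}" if "y \<in> N" for y
      using tight(2)[of "{v, z}" y] \<phi>_zero(2)[of y] v z that M by auto
    then have "N \<subseteq> {v, z}" by auto
    then have "(\<Sum>v\<in>N. x v) \<le> (\<Sum>v\<in>{v, z}. x v)" by (intro sum_mono2) (auto simp: x_nonneg)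
    also have "\<dots> = x v + x z" using \<open>v \<noteq> z\<close> by simp
    also have "\<dots> \<le> 2" using x_le_1[of v] x_le_1[of z] v z N_subset by fastforce
    finally show False using big by simp
  next
    case False
    then have "(\<Sum>v\<in>N. \<phi> v) = (\<Sum>v\<in>N. - x v)"
      using M M0 by (intro sum.cong) (auto simp: \<phi>_def)
    then show False
      using big sum_\<psi> Q_empty by (simp add: \<psi>_def sum_negf)
  qed
qed

text \<open>
  A vertex of \<open>M\<close> without a neighbour in \<open>M\<close> has charge at most \<open>-1\<close>, and two adjacent vertices of \<open>M\<close>
  have charge at most \<open>- 1 / 2\<close> each. So the slack is exhausted by a star or by a double star, and all
  remaining vertices of \<open>N\<close> have charge \<open>0\<close>, which makes them leaves attached to \<open>M\<close>.
\<close>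

lemma centre:
  obtains c where "c \<in> M" "x c = 1" "\<And>z. z \<in> N - {c} \<Longrightarrow> \<exists>y\<in>M. (z, y) \<in> E"
    "\<And>w. w \<in> W \<Longrightarrow> penalty w = 0" "l\<^sup>2 - l = real (card E) / 2 - 1"
proof -
  obtain c where c: "c \<in> M" using M_nonempty by auto
  then have cN: "c \<in> N" using M_subset by auto
  show ?thesis
  proof (cases "deg M c = 0")
    case True
    then have S: "{c} \<subseteq> N" "(\<Sum>v\<in>{c}. \<phi> v) \<le> - 1" using \<phi>_M[OF c] cN by auto
    note t = tight[OF S]
    show ?thesis
    proof (rule that[of c])
      show "x c = 1" using \<phi>_M(2)[OF c] t(1) True by simp
      show "\<exists>y\<in>M. (z, y) \<in> E" if "z \<in> N - {c}" for z using \<phi>_zero(2)[of z] t(2)[of z] that by auto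
    qed (use c t in auto)
  next
    case False
    then obtain d where d: "d \<in> M" "(c, d) \<in> E" using ex_nb_avoiding[of "{}" M c] by auto
    then have dN: "d \<in> N" and "c \<noteq> d" using M_subset adj_irrefl by auto
    have 1: "deg M c = 1" "deg M d \<le> 1" using deg_M_le_1[of c] deg_M_le_1[of d] cN dN False by auto
    have S: "{c, d} \<subseteq> N" "(\<Sum>v\<in>{c, d}. \<phi> v) \<le> - 1"
      using \<phi>_M(1)[OF c] \<phi>_M(1)[OF d(1)] 1 \<open>c \<noteq> d\<close> cN dN by auto
    note t = tight[OF S]
    have "\<phi> c + \<phi> d = - 1" using t(1) \<open>c \<noteq> d\<close> by simp
    then have "- 1 + deg M c / 2 \<le> \<phi> c" using \<phi>_M(1)[OF d(1)] 1 by simp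
    then have xc: "x c = 1" by (rule \<phi>_M(2)[OF c])
    show ?thesis
    proof (rule that[of c])
      show "\<exists>y\<in>M. (z, y) \<in> E" if "z \<in> N - {c}" for z
        using \<phi>_zero(2)[of z] t(2)[of z] that c d by (cases "z = d") (auto intro: adj_sym)
    qed (use c t xc in auto)
  qed
qed

text \<open>
  A vertex \<open>w\<close> with penalty \<open>0\<close> has no neighbour in \<open>W\<close>, and its weight is \<open>1\<close> because it is not isolated.
  So it has at least seven neighbours in \<open>N\<close>, although it is adjacent to the end of a path on three
  vertices in \<open>N\<close>, which allows three.
\<close>

lemma W_empty: "W = {}"
proof (rule ccontr)
  assume "W \<noteq> {}"
  then obtain w where w: "w \<in> W" by auto
  obtain c where c: "c \<in> M" "\<And>z. z \<in> N - {c} \<Longrightarrow> \<exists>y\<in>M. (z, y) \<in> E" "penalty w = 0"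
    using centre w by metis
  have wV: "w \<in> V" using w W_subset by auto
  have "0 \<le> deg N w * (1 - x w)" using x_le_1[OF wV] by simp
  with c(3) have p: "deg N w * (1 - x w) = 0" "deg W w = 0" unfolding penalty_def by linarith+
  obtain y where y: "(w, y) \<in> E" using not_isolated[OF wV] by auto
  then have "y \<in> nb V w" using arcs by (auto simp: nb_def)
  then have "y \<in> nb N w" using p(2) finite_nb[OF finite_W] by (auto simp: nb_V_W[OF w])
  then have "deg N w \<noteq> 0" using finite_nb[OF finite_N] by auto
  then have "x w = 1" using p(1) by simp
  then have 7: "7 \<le> deg N w"
    using weight_bound[OF wV] sum_nb_V_W[OF w, of "\<lambda>_. 1"] p(2) by auto
  then obtain z where z: "z \<in> N" "(w, z) \<in> E" "z \<notin> {c}"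
    using ex_nb_avoiding[of "{c}" N w] by auto
  then obtain y where "y \<in> M" "(z, y) \<in> E" using c(2)[of z] by auto
  then show False using deg_outside_le_3[OF w z(1,2)] 7 by simp
qed

end

context weighted_graph
begin

text \<open>
  The centre \<open>c\<close> also has weight \<open>1\<close>, so both \<open>u\<close> and \<open>c\<close> are adjacent to all other vertices. An edge that
  avoids both would form a triangle with \<open>c\<close> in the neighbourhood of \<open>u\<close>.
\<close>

lemma extremal_structure:
  assumes "u \<in> V" "x u = 1"
  obtains c where "c \<in> V" "u \<noteq> c"
    "E = {(v, w). v \<in> V \<and> w \<in> V \<and> v \<noteq> w \<and> (v \<in> {u, c} \<or> w \<in> {u, c})}"
    "l\<^sup>2 - l = real (card E) / 2 - 1"
proof -
  interpret u: peak V E x l u using assms by unfold_locales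
  obtain c where c: "c \<in> u.M" "x c = 1" "l\<^sup>2 - l = real (card E) / 2 - 1"
    using u.centre by metis
  have cN: "c \<in> u.N" and cV: "c \<in> V" using c u.M_subset u.N_subset by auto
  interpret c: peak V E x l c using c(2) cV by unfold_locales
  have du: "(u, v) \<in> E" if "v \<in> V" "v \<noteq> u" for v
    using that u.W_empty u.V_eq u.in_N by auto
  have dc: "(c, v) \<in> E" if "v \<in> V" "v \<noteq> c" for v
    using that c.W_empty c.V_eq c.in_N by auto
  have "u \<noteq> c" using cN u.u_notin by auto
  have rest: "v \<in> {u, c} \<or> w \<in> {u, c}" if e: "(v, w) \<in> E" for v w
  proof (rule ccontr)
    assume n: "\<not> ?thesis"
    have V: "v \<in> V" "w \<in> V" "v \<noteq> w" using e arcs adj_irrefl by auto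
    then have N: "v \<in> u.N" "w \<in> u.N" using du n by (auto simp: u.in_N)
    have cvw: "(c, v) \<in> E" "(c, w) \<in> E" using dc V n by auto
    have "v \<in> u.M" "w \<in> u.M"
      using two_le_deg[OF u.finite_N, of c w v] two_le_deg[OF u.finite_N, of c v w] N cN n cvw e
      by (auto simp: u.M_def intro: adj_sym)
    then have "c \<in> u.Q"
      using two_le_deg[OF u.finite_M, of v w c] cN cvw V by (auto simp: u.Q_def)
    then show False using u.Q_empty by simp
  qed
  have "E = {(v, w). v \<in> V \<and> w \<in> V \<and> v \<noteq> w \<and> (v \<in> {u, c} \<or> w \<in> {u, c})}"
    using arcs adj_irrefl rest du dc by (auto intro: adj_sym)
  then show ?thesis using that c(3) cV \<open>u \<noteq> c\<close> by blast
qed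

end

section \<open>From the spectral radius to a weighting of the vertices\<close>

lemma adjacency_matrix_mult_vec:
  assumes "distinct vs" "set vs = pverts G" "y \<in> carrier_vec (length vs)" "i < length vs"
    and "\<And>j. j < length vs \<Longrightarrow> y $ j = f (vs ! j)"
  shows "(adjacency_matrix G vs *\<^sub>v y) $ i = (\<Sum>w\<in>{w \<in> pverts G. (vs ! i, w) \<in> parcs G}. f w)"
proof -
  have bij: "bij_betw ((!) vs) {..<length vs} (pverts G)"
    using assms(1,2) by (intro bij_betw_nth) auto
  have "(adjacency_matrix G vs *\<^sub>v y) $ i =
      (\<Sum>j<length vs. (if (vs ! i, vs ! j) \<in> parcs G then 1 else 0) * y $ j)"
    using assms(3,4) by (simp add: adjacency_matrix_def scalar_prod_def lessThan_atLeast0)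
  also have "\<dots> = (\<Sum>j<length vs. if (vs ! i, vs ! j) \<in> parcs G then f (vs ! j) else 0)"
    using assms(5) by (intro sum.cong) auto
  also have "\<dots> = (\<Sum>w\<in>pverts G. if (vs ! i, w) \<in> parcs G then f w else 0)"
    by (rule sum.reindex_bij_betw[OF bij])
  also have "\<dots> = (\<Sum>w\<in>{w \<in> pverts G. (vs ! i, w) \<in> parcs G}. f w)"
    using assms(2) by (metis (no_types) List.finite_set sum.inter_filter)
  finally show ?thesis .
qed

lemma spectral_radius_ge:
  fixes f :: "'a \<Rightarrow> real"
  assumes "finite (pverts G)" "v \<in> pverts G" "f v \<noteq> 0"
    and eigen: "\<And>v. v \<in> pverts G \<Longrightarrow> (\<Sum>w\<in>{w \<in> pverts G. (v, w) \<in> parcs G}. f w) = k * f v"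
  shows "\<bar>k\<bar> \<le> graph_spectral_radius G"
proof -
  obtain vs where vs: "set vs = pverts G" "distinct vs"
    using finite_distinct_list[OF assms(1)] by auto
  let ?A = "adjacency_matrix G vs" and ?n = "length vs"
  define y where "y = vec ?n (\<lambda>i. complex_of_real (f (vs ! i)))"
  have A: "?A \<in> carrier_mat ?n ?n" by (simp add: adjacency_matrix_def)
  have n: "?n > 0" using assms(2) vs by (cases vs) auto
  obtain i where i: "i < ?n" "vs ! i = v" using assms(2) vs by (metis in_set_conv_nth)
  have "y \<noteq> 0\<^sub>v ?n"
  proof
    assume "y = 0\<^sub>v ?n"
    then have "y $ i = 0" using i by simp
    then show False using i assms(3) by (simp add: y_def)
  qed
  moreover have "?A *\<^sub>v y = complex_of_real k \<cdot>\<^sub>v y"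
  proof (rule eq_vecI)
    show "dim_vec (?A *\<^sub>v y) = dim_vec (complex_of_real k \<cdot>\<^sub>v y)"
      by (simp add: y_def adjacency_matrix_def)
    fix i assume "i < dim_vec (complex_of_real k \<cdot>\<^sub>v y)"
    then have i: "i < ?n" by (simp add: y_def)
    then have "vs ! i \<in> pverts G" using vs(1) nth_mem by blast
    have "(?A *\<^sub>v y) $ i = (\<Sum>w\<in>{w \<in> pverts G. (vs ! i, w) \<in> parcs G}. complex_of_real (f w))"
      using vs i by (intro adjacency_matrix_mult_vec) (auto simp: y_def)
    also have "\<dots> = complex_of_real (k * f (vs ! i))"
      unfolding eigen[OF \<open>vs ! i \<in> pverts G\<close>, symmetric] by simp
    finally show "(?A *\<^sub>v y) $ i = (complex_of_real k \<cdot>\<^sub>v y) $ i"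
      using i by (simp add: y_def)
  qed
  ultimately have "complex_of_real k \<in> spectrum ?A"
    unfolding spectrum_def eigenvalue_def eigenvector_def
    by (auto intro!: exI[of _ y] simp: y_def adjacency_matrix_def)
  then have "\<bar>k\<bar> \<le> spectral_radius ?A"
    by (intro spectral_radius_mem_max(2)[OF A n]) (auto intro!: image_eqI[of _ _ "complex_of_real k"])
  then show ?thesis using graph_spectral_radius_eq[OF vs(2,1)] by simp
qed

text \<open>
  If \<open>A y = k y\<close>, then the triangle inequality gives \<open>\<bar>k\<bar> \<bar>y\<bar> \<le> A \<bar>y\<bar>\<close> entrywise.
\<close>

lemma ex_subinvariant_weight:
  assumes "finite (pverts G)" "pverts G \<noteq> {}"
  obtains z :: "'a \<Rightarrow> real" where "\<And>v. 0 \<le> z v" "\<exists>v\<in>pverts G. 0 < z v"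
    "\<And>v. v \<in> pverts G \<Longrightarrow>
      graph_spectral_radius G * z v \<le> (\<Sum>w\<in>{w \<in> pverts G. (v, w) \<in> parcs G}. z w)"
proof -
  obtain vs where vs: "set vs = pverts G" "distinct vs"
    using finite_distinct_list[OF assms(1)] by auto
  let ?A = "adjacency_matrix G vs" and ?n = "length vs"
  have A: "?A \<in> carrier_mat ?n ?n" by (simp add: adjacency_matrix_def)
  have n: "?n > 0" using assms(2) vs by (cases vs) auto
  obtain k where k: "k \<in> spectrum ?A" "graph_spectral_radius G = norm k"
    using spectral_radius_mem_max(1)[OF A n] graph_spectral_radius_eq[OF vs(2,1)] by auto
  then obtain y where y: "y \<in> carrier_vec ?n" "y \<noteq> 0\<^sub>v ?n" "?A *\<^sub>v y = k \<cdot>\<^sub>v y"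
    unfolding spectrum_def eigenvalue_def eigenvector_def by (auto simp: adjacency_matrix_def)
  define f where "f v = y $ (the_inv_into {..<?n} ((!) vs) v)" for v
  have inj: "inj_on ((!) vs) {..<?n}" using vs(2) by (auto simp: inj_on_def nth_eq_iff_index_eq)
  have f: "y $ j = f (vs ! j)" if "j < ?n" for j
    using that by (simp add: f_def the_inv_into_f_f[OF inj])
  show ?thesis
  proof (rule that[of "\<lambda>v. norm (f v)"])
    show "\<exists>v\<in>pverts G. 0 < norm (f v)"
    proof (rule ccontr)
      assume "\<not> ?thesis"
      then have "y $ j = 0" if "j < ?n" for j using f[OF that] that vs by auto
      then have "y = 0\<^sub>v ?n" using y(1) by (intro eq_vecI) auto
      with y(2) show False ..
    qed
  next
    fix v assume "v \<in> pverts G"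
    then obtain i where i: "i < ?n" "vs ! i = v" using vs by (metis in_set_conv_nth)
    have "k * f v = (?A *\<^sub>v y) $ i" using y i f by auto
    also have "\<dots> = (\<Sum>w\<in>{w \<in> pverts G. (v, w) \<in> parcs G}. f w)"
      using adjacency_matrix_mult_vec[OF vs(2,1) y(1) i(1) f] i(2) by simp
    finally have "norm k * norm (f v) = norm (\<Sum>w\<in>{w \<in> pverts G. (v, w) \<in> parcs G}. f w)"
      by (simp flip: norm_mult)
    then show "graph_spectral_radius G * norm (f v) \<le>
        (\<Sum>w\<in>{w \<in> pverts G. (v, w) \<in> parcs G}. norm (f w))"
      unfolding k(2) using norm_sum[of f] by simp
  qed simp
qed

text \<open>
  Among the nonnegative nonzero \<open>z\<close> with \<open>l z \<le> A z\<close>, one with maximal support has a support that is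
  closed under adjacency: \<open>z + A z\<close> satisfies the same inequality, and its support also contains all
  neighbours of the support of \<open>z\<close>. Scaling then makes the maximum \<open>1\<close>.
\<close>

lemma (in domino_free_graph) ex_weighting:
  assumes "\<And>v. 0 \<le> z v" "\<exists>v\<in>V. 0 < z v" "\<And>v. v \<in> V \<Longrightarrow> l * z v \<le> (\<Sum>w\<in>nb V v. z w)"
  obtains x u where "\<And>v. 0 \<le> x v" "\<And>v. v \<in> V \<Longrightarrow> x v \<le> (1::real)"
    "\<And>v w. (v, w) \<in> E \<Longrightarrow> 0 < x v \<Longrightarrow> 0 < x w"
    "\<And>v. v \<in> V \<Longrightarrow> l * x v \<le> (\<Sum>w\<in>nb V v. x w)" "u \<in> V" "x u = 1"
proof -
  define P where "P z \<longleftrightarrow> (\<forall>v. 0 \<le> z v) \<and> (\<exists>v\<in>V. 0 < z v) \<and> (\<forall>v\<in>V. l * z v \<le> (\<Sum>w\<in>nb V v. z w))"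
    for z :: "'a \<Rightarrow> real"
  define supp where "supp z = {v \<in> V. 0 < z v}" for z :: "'a \<Rightarrow> real"
  have "P z" using assms by (simp add: P_def)
  moreover have "card (supp z) < Suc (card V)" for z
    using card_mono[OF finite_V, of "supp z"] by (auto simp: supp_def)
  ultimately obtain y where y: "P y" "\<And>z. P z \<Longrightarrow> card (supp z) \<le> card (supp y)"
    using ex_has_greatest_nat[of P z "\<lambda>z. card (supp z)" "Suc (card V)"] by metis
  have y0: "0 \<le> y v" for v using y(1) by (simp add: P_def)
  have closed: "0 < y w" if e: "(v, w) \<in> E" and v: "0 < y v" for v w
  proof (rule ccontr)
    assume w: "\<not> 0 < y w"
    define y' where "y' v = y v + (\<Sum>w\<in>nb V v. y w)" for v
    have ge: "y v \<le> y' v" for v using y0 by (simp add: y'_def sum_nonneg)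
    have "P y'"
      unfolding P_def
    proof (intro conjI ballI allI)
      show "0 \<le> y' v" for v using y0[of v] ge[of v] by linarith
      show "\<exists>v\<in>V. 0 < y' v" using y(1) ge unfolding P_def by (meson less_le_trans)
      fix v assume v: "v \<in> V"
      have "l * y' v = l * y v + (\<Sum>w\<in>nb V v. l * y w)"
        by (simp add: y'_def algebra_simps sum_distrib_left)
      also have "\<dots> \<le> (\<Sum>w\<in>nb V v. y w) + (\<Sum>w\<in>nb V v. \<Sum>w'\<in>nb V w. y w')"
        using y(1) v by (intro add_mono sum_mono) (auto simp: P_def nb_def)
      also have "\<dots> = (\<Sum>w\<in>nb V v. y' w)" by (simp add: y'_def sum.distrib)
      finally show "l * y' v \<le> (\<Sum>w\<in>nb V v. y' w)" .
    qed
    have "w \<in> V" "v \<in> nb V w" using e arcs adj_sym by (auto simp: nb_def)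
    then have "y v \<le> (\<Sum>w\<in>nb V w. y w)"
      using y0 by (intro member_le_sum) (auto intro: finite_nb finite_V)
    then have "0 < y' w" using v y0[of w] by (simp add: y'_def)
    then have "supp y \<subset> supp y'"
      using w \<open>w \<in> V\<close> ge by (auto simp: supp_def intro: less_le_trans)
    then have "card (supp y) < card (supp y')"
      using finite_V by (intro psubset_card_mono) (auto simp: supp_def)
    then show False using y(2)[OF \<open>P y'\<close>] by simp
  qed
  define mx where "mx = Max (y ` V)"
  have ne: "V \<noteq> {}" using assms(2) by auto
  have le: "y v \<le> mx" if "v \<in> V" for v
    using that finite_V by (simp add: mx_def)
  have pos: "0 < mx" using y(1) le unfolding P_def by (meson less_le_trans)
  have "mx \<in> y ` V" unfolding mx_def using ne finite_V by (intro Max_in) auto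
  then obtain u where u: "u \<in> V" "y u = mx" by auto
  show ?thesis
  proof (rule that[of "\<lambda>v. y v / mx" u])
    show "l * (y v / mx) \<le> (\<Sum>w\<in>nb V v. y w / mx)" if "v \<in> V" for v
      using y(1) that pos by (simp add: P_def divide_right_mono flip: sum_divide_distrib)
    show "0 < y w / mx" if "(v, w) \<in> E" "0 < y v / mx" for v w
      using closed that pos by (simp add: zero_less_divide_iff)
  qed (use y0 le pos u in auto)
qed

section \<open>Recognising the extremal graph\<close>

text \<open>
  The join \<open>K\<^sub>2 \<or> t K\<^sub>1\<close> described inside a given graph: \<open>u\<close> and \<open>c\<close> are the vertices of \<open>K\<^sub>2\<close>.
\<close>

definition book :: "'a pair_pre_digraph \<Rightarrow> 'a \<Rightarrow> 'a \<Rightarrow> bool" where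
  "book G u c \<longleftrightarrow> u \<in> pverts G \<and> c \<in> pverts G \<and> u \<noteq> c \<and> parcs G =
    {(v, w). v \<in> pverts G \<and> w \<in> pverts G \<and> v \<noteq> w \<and> (v \<in> {u, c} \<or> w \<in> {u, c})}"

lemma book_join:
  "book (graph_join (complete_graph 2) (empty_graph t)) (Inl 0) (Inl 1)"
proof -
  have 2: "{..<2} = {0, 1::nat}" by auto
  show ?thesis
    by (auto simp: book_def graph_join_def complete_graph_def empty_graph_def symcl_def 2 less_2_cases_iff
        image_iff)
qed

lemma card_pverts_join:
  "card (pverts (graph_join (complete_graph 2) (empty_graph t))) = t + 2"
  by (simp add: graph_join_def complete_graph_def empty_graph_def card_Plus)

lemma graph_iso_book:
  assumes G: "pair_graph G" and iso: "graph_iso G H" and H: "book H u c"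
  obtains u' c' where "book G u' c'"
proof -
  obtain f where f: "bij_betw f (pverts G) (pverts H)" "parcs H = map_prod f f ` parcs G"
    using iso unfolding graph_iso_iff[OF G] by blast
  have inj: "inj_on f (pverts G)" and im: "f ` pverts G = pverts H"
    using f(1) by (auto simp: bij_betw_def)
  have "u \<in> f ` pverts G" "c \<in> f ` pverts G" using H unfolding im by (simp_all add: book_def)
  then obtain u' c' where uc: "u' \<in> pverts G" "c' \<in> pverts G" "f u' = u" "f c' = c"
    by (elim imageE) simp
  have sub: "parcs G \<subseteq> pverts G \<times> pverts G" using G by (simp add: pair_graph_iff)
  have "(v, w) \<in> parcs G \<longleftrightarrow> v \<noteq> w \<and> (v \<in> {u', c'} \<or> w \<in> {u', c'})"
    if vw: "v \<in> pverts G" "w \<in> pverts G" for v w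
  proof -
    have "(v, w) \<in> parcs G \<longleftrightarrow> (f v, f w) \<in> parcs H"
    proof
      assume "(f v, f w) \<in> parcs H"
      then obtain v' w' where e: "(v', w') \<in> parcs G" "f v = f v'" "f w = f w'"
        unfolding f(2) by auto
      then have "v = v'" "w = w'" using vw sub by (auto dest: inj_onD[OF inj])
      then show "(v, w) \<in> parcs G" using e by simp
    qed (force simp: f(2))
    also have "\<dots> \<longleftrightarrow> f v \<noteq> f w \<and> (f v \<in> {u, c} \<or> f w \<in> {u, c})"
      using H vw im unfolding book_def by auto
    also have "\<dots> \<longleftrightarrow> v \<noteq> w \<and> (v \<in> {u', c'} \<or> w \<in> {u', c'})"
      unfolding uc(3,4)[symmetric] using inj_on_eq_iff[OF inj] vw uc(1,2) by simp
    finally show ?thesis .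
  qed
  moreover have "u' \<noteq> c'" using H uc by (auto simp: book_def)
  ultimately have "book G u' c'" using uc sub unfolding book_def by auto
  then show ?thesis by (rule that)
qed

lemma book_iso_book:
  assumes G: "pair_graph G" and b: "book G u c" "book H u' c'"
    and fin: "finite (pverts H)" and card: "card (pverts G) = card (pverts H)"
  shows "graph_iso G H"
proof -
  have finG: "finite (pverts G)" using G by (simp add: pair_graph_iff)
  have "card (pverts G - {u, c}) = card (pverts H - {u', c'})"
    using b card fin finG by (simp add: book_def card_Diff_subset)
  then obtain g where g: "bij_betw g (pverts G - {u, c}) (pverts H - {u', c'})"
    using finite_same_card_bij[of "pverts G - {u, c}" "pverts H - {u', c'}"] fin finG by blast
  define f where "f v = (if v = u then u' else if v = c then c' else g v)" for v
  have "bij_betw f (pverts G - {u, c}) (pverts H - {u', c'})"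
    using g by (rule bij_betw_cong[THEN iffD1, rotated]) (auto simp: f_def)
  moreover have "bij_betw f {u, c} {u', c'}"
    using b by (auto simp: book_def f_def bij_betw_def inj_on_def)
  ultimately have "bij_betw f ((pverts G - {u, c}) \<union> {u, c}) ((pverts H - {u', c'}) \<union> {u', c'})"
    by (rule bij_betw_combine) auto
  moreover have "(pverts G - {u, c}) \<union> {u, c} = pverts G" "(pverts H - {u', c'}) \<union> {u', c'} = pverts H"
    using b by (auto simp: book_def)
  ultimately have bij: "bij_betw f (pverts G) (pverts H)" by simp
  then have inj: "inj_on f (pverts G)" and im: "f ` pverts G = pverts H"
    by (auto simp: bij_betw_def)
  have fuc: "f v \<in> {u', c'} \<longleftrightarrow> v \<in> {u, c}" if "v \<in> pverts G" for v
  proof -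
    have "u \<in> pverts G" "c \<in> pverts G" "f u = u'" "f c = c'"
      using b(1) by (auto simp: book_def f_def)
    then show ?thesis using inj_on_eq_iff[OF inj] that by (metis insert_iff singletonD)
  qed
  have "parcs H = map_prod f f ` parcs G"
  proof (rule Set.set_eqI)
    fix e :: "'b \<times> 'b"
    obtain v' w' where e: "e = (v', w')" by (cases e)
    show "e \<in> parcs H \<longleftrightarrow> e \<in> map_prod f f ` parcs G"
    proof
      assume "e \<in> parcs H"
      then have h: "v' \<in> pverts H" "w' \<in> pverts H" "v' \<noteq> w'" "v' \<in> {u', c'} \<or> w' \<in> {u', c'}"
        using b(2) e by (auto simp: book_def)
      then obtain v w where "v \<in> pverts G" "w \<in> pverts G" "v' = f v" "w' = f w"
        using im by (metis imageE)
      moreover from this have "v \<in> {u, c} \<or> w \<in> {u, c}" "v \<noteq> w" using h fuc by auto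
      ultimately have "(v, w) \<in> parcs G" using b(1) unfolding book_def by auto
      then show "e \<in> map_prod f f ` parcs G" using \<open>v' = f v\<close> \<open>w' = f w\<close> e by auto
    next
      assume "e \<in> map_prod f f ` parcs G"
      then obtain v w where vw: "(v, w) \<in> parcs G" "v' = f v" "w' = f w" using e by auto
      then have g: "v \<in> pverts G" "w \<in> pverts G" "v \<noteq> w" "v \<in> {u, c} \<or> w \<in> {u, c}"
        using b(1) by (auto simp: book_def)
      then have "f v \<noteq> f w" "f v \<in> {u', c'} \<or> f w \<in> {u', c'}" "f v \<in> pverts H" "f w \<in> pverts H"
        using inj fuc im by (auto simp: inj_on_def)
      then show "e \<in> parcs H" using b(2) e vw unfolding book_def by auto
    qed
  qed
  then show ?thesis unfolding graph_iso_iff[OF G] using bij by blast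
qed

lemma book_nb:
  assumes "book G u c" "v \<in> pverts G"
  shows "{w \<in> pverts G. (v, w) \<in> parcs G} =
    (if v = u then insert c (pverts G - {u, c}) else if v = c then insert u (pverts G - {u, c})
     else {u, c})"
  using assms by (auto simp: book_def)

lemma card_arcs_book:
  assumes "finite (pverts G)" "book G u c"
  shows "card (parcs G) = 2 * (2 * (card (pverts G) - 2) + 1)"
proof -
  let ?L = "pverts G - {u, c}"
  have b: "u \<noteq> c" "u \<in> pverts G" "c \<in> pverts G" using assms by (auto simp: book_def)
  have L: "finite ?L" "card ?L = card (pverts G) - 2"
    using assms(1) b by (auto simp: card_Diff_subset)
  have "parcs G = {(u, c), (c, u)} \<union> ({u, c} \<times> ?L \<union> ?L \<times> {u, c})"
    using assms(2) by (auto simp: book_def)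
  also have "card \<dots> = card {(u, c), (c, u)} + card ({u, c} \<times> ?L \<union> ?L \<times> {u, c})"
    using L by (intro card_Un_disjoint) auto
  also have "card ({u, c} \<times> ?L \<union> ?L \<times> {u, c}) = card ({u, c} \<times> ?L) + card (?L \<times> {u, c})"
    using L by (intro card_Un_disjoint) auto
  finally show ?thesis using b L by (simp add: card_cartesian_product)
qed

text \<open>
  The weighting with value \<open>k\<close> at \<open>u\<close> and \<open>c\<close> and \<open>2\<close> elsewhere is an eigenvector for \<open>k\<close>: the row of a
  common neighbour of \<open>u\<close> and \<open>c\<close> gives \<open>k + k = 2 k\<close>, and that of \<open>u\<close> gives \<open>k + 2 t = k\<^sup>2\<close> if there
  are \<open>t\<close> common neighbours.
\<close>

lemma spectral_radius_book_ge:
  assumes fin: "finite (pverts G)" and b: "book G u c"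
    and k: "0 \<le> k" "k\<^sup>2 - k = 2 * (real (card (pverts G)) - 2)"
    and ne: "3 \<le> card (pverts G)"
  shows "k \<le> graph_spectral_radius G"
proof -
  let ?L = "pverts G - {u, c}"
  define f where "f v = (if v \<in> {u, c} then k else 2)" for v
  have uc: "u \<noteq> c" "u \<in> pverts G" "c \<in> pverts G" using b by (auto simp: book_def)
  have L: "finite ?L" "card ?L = card (pverts G) - 2"
    using fin uc by (auto simp: card_Diff_subset)
  have "(\<Sum>w\<in>?L. f w) = (\<Sum>w\<in>?L. 2)" by (intro sum.cong) (auto simp: f_def)
  then have sL: "(\<Sum>w\<in>?L. f w) = 2 * (real (card (pverts G)) - 2)"
    using L ne by simp
  have "?L \<noteq> {}" using L ne by (metis card.empty diff_is_0_eq not_less_eq_eq numeral_2_eq_2 numeral_3_eq_3)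
  then obtain v where v: "v \<in> ?L" by auto
  have "\<bar>k\<bar> \<le> graph_spectral_radius G"
  proof (rule spectral_radius_ge[OF fin, of v f])
    show "v \<in> pverts G" "f v \<noteq> 0" using v by (auto simp: f_def)
    fix w assume w: "w \<in> pverts G"
    show "(\<Sum>w'\<in>{w' \<in> pverts G. (w, w') \<in> parcs G}. f w') = k * f w"
      unfolding book_nb[OF b w] using uc L sL k
      by (auto simp: f_def power2_eq_square algebra_simps)
  qed
  then show ?thesis using k by simp
qed

section \<open>The spectral bound for theta-free graphs\<close>

lemma card_edges:
  assumes "pair_graph G"
  shows "card (parcs G) = 2 * card (edges G)"
proof -
  interpret pair_graph G by fact
  have fin: "finite (parcs G)" by simp
  have sym: "(v, u) \<in> parcs G" if "(u, v) \<in> parcs G" for u v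
    using that assms by (auto simp: pair_graph_iff dest: symD)
  have irr: "(v, v) \<notin> parcs G" for v
    using assms by (auto simp: pair_graph_iff irrefl_def)
  let ?h = "\<lambda>(u, v). {u, v}"
  have im: "?h ` parcs G = edges G" by (auto simp: edges_def)
  have "card (parcs G) = (\<Sum>e\<in>edges G. card {a \<in> parcs G. ?h a = e})"
    using sum.image_gen[OF fin, of "\<lambda>_. 1::nat" ?h] by (simp add: im)
  also have "\<dots> = (\<Sum>e\<in>edges G. 2)"
  proof (rule sum.cong)
    fix e assume "e \<in> edges G"
    then obtain u v where e: "e = {u, v}" "(u, v) \<in> parcs G" by (auto simp: edges_def)
    then have "{a \<in> parcs G. ?h a = e} = {(u, v), (v, u)}"
      using sym by (auto simp: doubleton_eq_iff)
    moreover have "u \<noteq> v" using e irr by auto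
    ultimately show "card {a \<in> parcs G. ?h a = e} = 2" by simp
  qed simp
  finally show ?thesis by simp
qed

lemma domino_free_graph_if_theta_free:
  assumes G: "pair_graph G" and free: "graph_free (theta_graph 1 3 3) G"
  shows "domino_free_graph (pverts G) (parcs G)"
proof
  show "finite (pverts G)" "parcs G \<subseteq> pverts G \<times> pverts G" "(v, v) \<notin> parcs G" for v
    using G by (auto simp: pair_graph_iff irrefl_def)
  show sym: "(w, v) \<in> parcs G" if "(v, w) \<in> parcs G" for v w
    using that G by (auto simp: pair_graph_iff dest: symD)
  fix s t a b c d
  assume dist: "distinct [s, t, a, b, c, d]" and e: "(s, t) \<in> parcs G" "(s, a) \<in> parcs G"
    "(a, b) \<in> parcs G" "(b, t) \<in> parcs G" "(s, c) \<in> parcs G" "(c, d) \<in> parcs G" "(d, t) \<in> parcs G"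
  define f where "f p = (case p of Source \<Rightarrow> s | Sink \<Rightarrow> t |
    Internal i j \<Rightarrow> if i = 2 then if j = 1 then a else b else if j = 1 then c else d)" for p
  have "inj_on f (pverts (theta_graph 1 3 3))"
    using dist unfolding theta_graph_1_3_3 f_def by (auto simp: inj_on_def)
  moreover have "f ` pverts (theta_graph 1 3 3) \<subseteq> pverts G"
    using e G unfolding theta_graph_1_3_3 f_def by (auto simp: pair_graph_iff)
  moreover have "map_prod f f ` parcs (theta_graph 1 3 3) \<subseteq> parcs G"
    using e sym unfolding theta_graph_1_3_3 f_def by (auto simp: symcl_def)
  ultimately show False
    using free graph_free_iff[OF pair_graph_theta_graph G] by blast
qed

lemma book_if_spectral_radius_large:
  fixes G :: "'a pair_pre_digraph" and m :: nat
  assumes m: "m \<ge> 43" and G: "pair_graph G" and free: "graph_free (theta_graph 1 3 3) G"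
    and edges: "card (edges G) = m" and iso: "no_isolated_vertices G"
    and large: "(1 + sqrt (4 * real m - 3)) / 2 \<le> graph_spectral_radius G"
  shows "graph_spectral_radius G = (1 + sqrt (4 * real m - 3)) / 2" "\<exists>u c. book G u c"
proof -
  let ?l = "graph_spectral_radius G" and ?s = "sqrt (4 * real m - 3)"
  interpret domino_free_graph "pverts G" "parcs G"
    by (rule domino_free_graph_if_theta_free[OF G free])
  have cE: "card (parcs G) = 2 * m" using card_edges[OF G] edges by simp
  have ne: "pverts G \<noteq> {}" using arcs cE m by auto
  obtain z where z: "\<And>v. 0 \<le> z v" "\<exists>v\<in>pverts G. 0 < z v"
    "\<And>v. v \<in> pverts G \<Longrightarrow> ?l * z v \<le> (\<Sum>w\<in>{w \<in> pverts G. (v, w) \<in> parcs G}. z w)"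
    using ex_subinvariant_weight[OF finite_V ne] by blast
  obtain x u where x: "\<And>v. 0 \<le> x v" "\<And>v. v \<in> pverts G \<Longrightarrow> x v \<le> 1"
    "\<And>v w. (v, w) \<in> parcs G \<Longrightarrow> 0 < x v \<Longrightarrow> 0 < x w"
    "\<And>v. v \<in> pverts G \<Longrightarrow> ?l * x v \<le> (\<Sum>w\<in>nb (pverts G) v. x w)" and u: "u \<in> pverts G" "x u = 1"
    by (rule ex_weighting[OF z[folded nb_def]]) (assumption | rule that)+
  have "sqrt 169 \<le> ?s" using m by (intro real_sqrt_le_mono) auto
  moreover have "sqrt 169 = (13::real)" by (rule real_sqrt_unique) auto
  ultimately have s: "13 \<le> ?s" by simp
  have "3 \<le> real m" using m by simp
  then have s2: "?s\<^sup>2 = 4 * real m - 3" by (intro real_sqrt_pow2) simp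
  have "?s\<^sup>2 \<le> (2 * ?l - 1)\<^sup>2"
  proof (rule power_mono)
    have "b \<le> 2 * l - 1" if "(1 + b) / 2 \<le> l" for b l :: real using that by simp
    then show "?s \<le> 2 * ?l - 1" using large .
    show "0 \<le> ?s" by (rule order_trans[OF _ s]) simp
  qed
  then have l2: "real m - 1 \<le> ?l\<^sup>2 - ?l" unfolding s2 by (simp add: power2_eq_square algebra_simps)
  interpret weighted_graph "pverts G" "parcs G" x ?l
  proof
    show "\<exists>w. (v, w) \<in> parcs G" if "v \<in> pverts G" for v
      using that iso by (auto simp: no_isolated_vertices_def)
    show "7 \<le> ?l" using large s by simp
    show "real (card (parcs G)) / 2 - 1 \<le> ?l\<^sup>2 - ?l" using l2 cE by simp
  qed (use x in auto)
  obtain c where c: "c \<in> pverts G" "u \<noteq> c" "parcs G = {(v, w). v \<in> pverts G \<and> w \<in> pverts G \<and>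
      v \<noteq> w \<and> (v \<in> {u, c} \<or> w \<in> {u, c})}" "?l\<^sup>2 - ?l = real (card (parcs G)) / 2 - 1"
    by (rule extremal_structure[OF u])
  have "(2 * ?l - 1)\<^sup>2 = 4 * real m - 3"
    using c(4) cE by (simp add: power2_eq_square algebra_simps)
  then have "?s = 2 * ?l - 1" using l_ge_7 by (intro real_sqrt_unique) auto
  moreover have "book G u c" using c u by (simp add: book_def)
  ultimately show "?l = (1 + ?s) / 2" "\<exists>u c. book G u c" by auto
qed

theorem theorem1p4:
  fixes G :: "'a pair_pre_digraph" and m :: nat
  assumes "m \<ge> 43"
    and "pair_graph G"
    and "graph_free (theta_graph 1 3 3) G"
    and "card (edges G) = m"
    and "no_isolated_vertices G"
  shows "graph_spectral_radius G \<le> (1 + sqrt (4 * real m - 3)) / 2 \<and>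
    (graph_spectral_radius G = (1 + sqrt (4 * real m - 3)) / 2 \<longleftrightarrow>
      odd m \<and> graph_iso G (graph_join (complete_graph 2) (empty_graph ((m - 1) div 2))))"
proof -
  note G = assms(2)
  let ?l = "graph_spectral_radius G" and ?b = "(1 + sqrt (4 * real m - 3)) / 2"
  let ?t = "(m - 1) div 2"
  let ?J = "graph_join (complete_graph 2) (empty_graph ?t)"
  have fin: "finite (pverts G)" using G by (simp add: pair_graph_iff)
  have cE: "card (parcs G) = 2 * m" using card_edges[OF G] assms(4) by simp
  have upper: "?l \<le> ?b"
    using book_if_spectral_radius_large(1)[OF assms] by linarith
  have "odd m \<and> graph_iso G ?J" if "?l = ?b"
  proof -
    have "\<exists>u c. book G u c"
      by (rule book_if_spectral_radius_large(2)[OF assms]) (use that in simp)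
    then obtain u c where b: "book G u c" by blast
    have "{u, c} \<subseteq> pverts G" "u \<noteq> c" using b by (auto simp: book_def)
    from card_mono[OF fin this(1)] this(2) have "2 \<le> card (pverts G)" by simp
    moreover have m: "m = 2 * (card (pverts G) - 2) + 1" using card_arcs_book[OF fin b] cE by simp
    ultimately have "card (pverts G) = card (pverts ?J)" unfolding card_pverts_join by auto
    moreover have "finite (pverts ?J)"
      by (simp add: graph_join_def complete_graph_def empty_graph_def)
    ultimately have "graph_iso G ?J" using book_iso_book[OF G b book_join] by blast
    moreover have "odd m" by (subst m) simp
    ultimately show ?thesis by blast
  qed
  moreover have "?l = ?b" if iso: "odd m \<and> graph_iso G ?J"
  proof -
    obtain u c where b: "book G u c"
      by (rule graph_iso_book[OF G conjunct2[OF iso] book_join])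
    have "{u, c} \<subseteq> pverts G" "u \<noteq> c" using b by (auto simp: book_def)
    from card_mono[OF fin this(1)] this(2) have 2: "2 \<le> card (pverts G)" by simp
    have m: "m = 2 * (card (pverts G) - 2) + 1" using card_arcs_book[OF fin b] cE by simp
    have "?b \<le> ?l"
    proof (rule spectral_radius_book_ge[OF fin b])
      have "?b\<^sup>2 - ?b = ((sqrt (4 * real m - 3))\<^sup>2 - 1) / 4"
        by (simp add: power2_eq_square field_simps)
      also have "\<dots> = real m - 1" using assms(1) by simp
      also have "\<dots> = 2 * (real (card (pverts G)) - 2)"
        using 2 arg_cong[OF m, of real] by simp
      finally show "?b\<^sup>2 - ?b = 2 * (real (card (pverts G)) - 2)" .
      show "0 \<le> ?b" using assms(1) by simp
      show "3 \<le> card (pverts G)" using m assms(1) by simp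
    qed
    with upper show ?thesis by simp
  qed
  ultimately show ?thesis using upper by blast
qed

end
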